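(* Let $R$ be a commutative Noetherian ring with identity and $\mathfrak{a}$ an ideal of $R$. Let $M,N$ be finitely generated $R$-modules such that $M=\Gamma_{\mathfrak{a}}(M)$ and $\operatorname{cd}(\mathfrak{a},N)=1$. Then $H^{i}_{\mathfrak{a}}(M,N)$ is finitely generated for all $i\ge 0$.
   Context: $\Gamma_{\mathfrak{a}}$ is the $\mathfrak{a}$-torsion functor and $H^{i}_{\mathfrak{a}}(N)$ is the $i$-th ordinary local cohomology module of $N$. $\operatorname{cd}(\mathfrak{a},N)$ is the largest integer $i$ for which $H^{i}_{\mathfrak{a}}(N)$ is non-zero. The generalized local cohomology modules are $H^{i}_{\mathfrak{a}}(M,N)=\varinjlim_{n}\operatorname{Ext}^{i}_{R}(M/\mathfrak{a}^{n}M,N)$. *)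

theory Defs
  imports "HOL-Library.Extended_Real" "HOL-Algebra.Ideal_Product" "HOL-Algebra.Module"
    "HOL-Algebra.Ring_Divisibility"
begin

text \<open>
  Modules are records of type \<open>('a, 'm, 'z) module_scheme\<close> satisfying the locale
  \<^term>\<open>Module.module\<close>. The record inherits the fields \<open>mult\<close> and \<open>one\<close> from rings; they play
  no role for modules and are left \<^term>\<open>undefined\<close> in the constructions below.
\<close>


section \<open>Modules\<close>

definition mod_hom ::
  "('a, 'r) ring_scheme \<Rightarrow> ('a, 'm, 'x) module_scheme \<Rightarrow> ('a, 'n, 'y) module_scheme \<Rightarrow> ('m \<Rightarrow> 'n) set"
  where
  "mod_hom R A B = {f \<in> carrier A \<rightarrow> carrier B.
     (\<forall>x \<in> carrier A. \<forall>y \<in> carrier A. f (x \<oplus>\<^bsub>A\<^esub> y) = f x \<oplus>\<^bsub>B\<^esub> f y) \<and>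
     (\<forall>r \<in> carrier R. \<forall>x \<in> carrier A. f (r \<odot>\<^bsub>A\<^esub> x) = r \<odot>\<^bsub>B\<^esub> f x)}"

definition hom_module ::
  "('a, 'r) ring_scheme \<Rightarrow> ('a, 'm, 'x) module_scheme \<Rightarrow> ('a, 'n, 'y) module_scheme
    \<Rightarrow> ('a, 'm \<Rightarrow> 'n) module"
  where
  "hom_module R A B =
    \<lparr>carrier = mod_hom R A B \<inter> extensional (carrier A),
     monoid.mult = undefined, one = undefined,
     ring.zero = (\<lambda>x \<in> carrier A. \<zero>\<^bsub>B\<^esub>),
     add = (\<lambda>f g. \<lambda>x \<in> carrier A. f x \<oplus>\<^bsub>B\<^esub> g x),
     smult = (\<lambda>r f. \<lambda>x \<in> carrier A. r \<odot>\<^bsub>B\<^esub> f x)\<rparr>"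

definition quotient_module :: "('a, 'm, 'x) module_scheme \<Rightarrow> 'm set \<Rightarrow> ('a, 'm set) module"
  where
  "quotient_module M H =
    \<lparr>carrier = a_rcosets\<^bsub>M\<^esub> H,
     monoid.mult = undefined, one = undefined,
     ring.zero = H,
     add = set_add M,
     smult = (\<lambda>r X. \<Union>x \<in> X. H +>\<^bsub>M\<^esub> (r \<odot>\<^bsub>M\<^esub> x))\<rparr>"

definition gen_submodule ::
  "('a, 'r) ring_scheme \<Rightarrow> ('a, 'm, 'x) module_scheme \<Rightarrow> 'm set \<Rightarrow> 'm set"
  where "gen_submodule R M S = \<Inter> {H. submodule H R M \<and> S \<subseteq> H}"

definition fg_module :: "('a, 'r) ring_scheme \<Rightarrow> ('a, 'm, 'x) module_scheme \<Rightarrow> bool"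
  where
  "fg_module R M \<longleftrightarrow> Module.module R M \<and>
     (\<exists>S. finite S \<and> S \<subseteq> carrier M \<and> gen_submodule R M S = carrier M)"

definition is_zero_module :: "('a, 'm, 'x) module_scheme \<Rightarrow> bool"
  where "is_zero_module M \<longleftrightarrow> carrier M = {\<zero>\<^bsub>M\<^esub>}"

text \<open>Ideal powers are taken in the library's monoid \<^term>\<open>ideals_set R\<close>, so \<open>I\<^sup>0 = R\<close>.\<close>

definition ideal_power :: "('a, 'r) ring_scheme \<Rightarrow> 'a set \<Rightarrow> nat \<Rightarrow> 'a set"
  where "ideal_power R I n = I [^]\<^bsub>ideals_set R\<^esub> n"

definition ideal_smult ::
  "('a, 'r) ring_scheme \<Rightarrow> 'a set \<Rightarrow> ('a, 'm, 'x) module_scheme \<Rightarrow> 'm set"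
  where "ideal_smult R I M = gen_submodule R M {r \<odot>\<^bsub>M\<^esub> x | r x. r \<in> I \<and> x \<in> carrier M}"

definition torsion :: "('a, 'r) ring_scheme \<Rightarrow> 'a set \<Rightarrow> ('a, 'm, 'x) module_scheme \<Rightarrow> 'm set"
  where
  "torsion R I M = {x \<in> carrier M. \<exists>n. \<forall>r \<in> ideal_power R I n. r \<odot>\<^bsub>M\<^esub> x = \<zero>\<^bsub>M\<^esub>}"

definition torsion_module ::
  "('a, 'r) ring_scheme \<Rightarrow> 'a set \<Rightarrow> ('a, 'm, 'x) module_scheme \<Rightarrow> ('a, 'm, 'x) module_scheme"
  where "torsion_module R I M = M\<lparr>carrier := torsion R I M\<rparr>"


section \<open>Cohomology of cochain complexes\<close>

definition cocycles ::
  "(nat \<Rightarrow> ('a, 'm, 'x) module_scheme) \<Rightarrow> (nat \<Rightarrow> 'm \<Rightarrow> 'm) \<Rightarrow> nat \<Rightarrow> 'm set"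
  where "cocycles C d i = {x \<in> carrier (C i). d i x = \<zero>\<^bsub>C (Suc i)\<^esub>}"

definition coboundaries ::
  "(nat \<Rightarrow> ('a, 'm, 'x) module_scheme) \<Rightarrow> (nat \<Rightarrow> 'm \<Rightarrow> 'm) \<Rightarrow> nat \<Rightarrow> 'm set"
  where
  "coboundaries C d i = (case i of 0 \<Rightarrow> {\<zero>\<^bsub>C 0\<^esub>} | Suc j \<Rightarrow> d j ` carrier (C j))"

definition cohomology ::
  "(nat \<Rightarrow> ('a, 'm, 'x) module_scheme) \<Rightarrow> (nat \<Rightarrow> 'm \<Rightarrow> 'm) \<Rightarrow> nat \<Rightarrow> ('a, 'm set) module"
  where
  "cohomology C d i =
     quotient_module ((C i)\<lparr>carrier := cocycles C d i\<rparr>) (coboundaries C d i)"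


section \<open>A functorial free resolution\<close>

text \<open>
  Elements of the free module \<open>R\<^sup>(\<^sup>B\<^sup>)\<close> are the finitely supported functions on \<open>B\<close>,
  extended by zero.
\<close>

definition free_module :: "('a, 'r) ring_scheme \<Rightarrow> 'b set \<Rightarrow> ('a, 'b \<Rightarrow> 'a) module"
  where
  "free_module R B =
    \<lparr>carrier = {v \<in> UNIV \<rightarrow> carrier R. finite {b. v b \<noteq> \<zero>\<^bsub>R\<^esub>} \<and> {b. v b \<noteq> \<zero>\<^bsub>R\<^esub>} \<subseteq> B},
     monoid.mult = undefined, one = undefined,
     ring.zero = (\<lambda>_. \<zero>\<^bsub>R\<^esub>),
     add = (\<lambda>v w b. v b \<oplus>\<^bsub>R\<^esub> w b),
     smult = (\<lambda>r v b. r \<otimes>\<^bsub>R\<^esub> v b)\<rparr>"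

text \<open>
  The free modules \<open>F\<^sub>0, F\<^sub>1, \<dots>\<close> of the resolution of \<open>M\<close> have bases of cells. The basis of
  \<open>F\<^sub>0\<close> is \<open>{Gen m | m \<in> M}\<close>, with \<open>Gen m\<close> augmented to \<open>m\<close>. The basis of \<open>F\<^sub>i\<^sub>+\<^sub>1\<close> consists of
  all cells \<open>Rel l\<close>, where \<open>l\<close> is a list of pairs (coefficient, basis element of \<open>F\<^sub>i\<close>) whose
  linear combination lies in the kernel of the previous map (the augmentation
  \<open>F\<^sub>0 \<rightarrow> M\<close> or \<open>F\<^sub>i \<rightarrow> F\<^sub>i\<^sub>-\<^sub>1\<close>), and the differential sends \<open>Rel l\<close> to this linear
  combination. So the basis maps onto each kernel and the complex is a free resolution of \<open>M\<close>.
  Using formal linear combinations (lists) instead of their values keeps all degrees in one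
  type and makes the construction strictly functorial: a homomorphism \<open>M \<rightarrow> M'\<close> acts on cells
  by \<^term>\<open>map_cell\<close>.
\<close>

datatype ('a, 'm) cell = Gen 'm | Rel "('a \<times> ('a, 'm) cell) list"

definition lincomb :: "('a, 'r) ring_scheme \<Rightarrow> ('a \<times> 'b) list \<Rightarrow> 'b \<Rightarrow> 'a"
  where
  "lincomb R l b = foldr (\<lambda>(r, c) s. (if c = b then r else \<zero>\<^bsub>R\<^esub>) \<oplus>\<^bsub>R\<^esub> s) l \<zero>\<^bsub>R\<^esub>"

definition res_aug ::
  "('a, 'r) ring_scheme \<Rightarrow> ('a, 'm, 'x) module_scheme \<Rightarrow> (('a, 'm) cell \<Rightarrow> 'a) \<Rightarrow> 'm"
  where
  "res_aug R M v =
     (\<Oplus>\<^bsub>M\<^esub>c \<in> {c. v c \<noteq> \<zero>\<^bsub>R\<^esub>}. v c \<odot>\<^bsub>M\<^esub> (case c of Gen m \<Rightarrow> m | Rel l \<Rightarrow> \<zero>\<^bsub>M\<^esub>))"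

definition res_diff ::
  "('a, 'r) ring_scheme \<Rightarrow> (('a, 'm) cell \<Rightarrow> 'a) \<Rightarrow> ('a, 'm) cell \<Rightarrow> 'a"
  where
  "res_diff R v b =
     (\<Oplus>\<^bsub>R\<^esub>c \<in> {c. v c \<noteq> \<zero>\<^bsub>R\<^esub>}.
        v c \<otimes>\<^bsub>R\<^esub> (case c of Gen m \<Rightarrow> \<zero>\<^bsub>R\<^esub> | Rel l \<Rightarrow> lincomb R l b))"

fun res_basis ::
  "('a, 'r) ring_scheme \<Rightarrow> ('a, 'm, 'x) module_scheme \<Rightarrow> nat \<Rightarrow> ('a, 'm) cell set"
  where
  "res_basis R M 0 = Gen ` carrier M"
| "res_basis R M (Suc 0) =
     Rel ` {l \<in> lists (carrier R \<times> res_basis R M 0). res_aug R M (lincomb R l) = \<zero>\<^bsub>M\<^esub>}"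
| "res_basis R M (Suc (Suc i)) =
     Rel ` {l \<in> lists (carrier R \<times> res_basis R M (Suc i)).
              res_diff R (lincomb R l) = (\<lambda>_. \<zero>\<^bsub>R\<^esub>)}"

definition res_module ::
  "('a, 'r) ring_scheme \<Rightarrow> ('a, 'm, 'x) module_scheme \<Rightarrow> nat \<Rightarrow> ('a, ('a, 'm) cell \<Rightarrow> 'a) module"
  where "res_module R M i = free_module R (res_basis R M i)"

definition res_map ::
  "('a, 'r) ring_scheme \<Rightarrow> ('m \<Rightarrow> 'n) \<Rightarrow> (('a, 'm) cell \<Rightarrow> 'a) \<Rightarrow> ('a, 'n) cell \<Rightarrow> 'a"
  where
  "res_map R h v b = (\<Oplus>\<^bsub>R\<^esub>c \<in> {c. v c \<noteq> \<zero>\<^bsub>R\<^esub> \<and> map_cell id h c = b}. v c)"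


section \<open>Ext\<close>

definition ext_complex ::
  "('a, 'r) ring_scheme \<Rightarrow> ('a, 'm, 'x) module_scheme \<Rightarrow> ('a, 'n, 'y) module_scheme \<Rightarrow> nat
    \<Rightarrow> ('a, (('a, 'm) cell \<Rightarrow> 'a) \<Rightarrow> 'n) module"
  where "ext_complex R M N i = hom_module R (res_module R M i) N"

definition ext_diff ::
  "('a, 'r) ring_scheme \<Rightarrow> ('a, 'm, 'x) module_scheme \<Rightarrow> nat
    \<Rightarrow> ((('a, 'm) cell \<Rightarrow> 'a) \<Rightarrow> 'n) \<Rightarrow> (('a, 'm) cell \<Rightarrow> 'a) \<Rightarrow> 'n"
  where "ext_diff R M i f = (\<lambda>v \<in> carrier (res_module R M (Suc i)). f (res_diff R v))"

definition Ext ::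
  "('a, 'r) ring_scheme \<Rightarrow> nat \<Rightarrow> ('a, 'm, 'x) module_scheme \<Rightarrow> ('a, 'n, 'y) module_scheme
    \<Rightarrow> ('a, ((('a, 'm) cell \<Rightarrow> 'a) \<Rightarrow> 'n) set) module"
  where "Ext R i M N = cohomology (ext_complex R M N) (ext_diff R M) i"

text \<open>
  \<open>Ext_map R i M N h\<close> is the map from \<open>Ext\<^sup>i(M', N)\<close> to \<open>Ext\<^sup>i(M, N)\<close> induced by a homomorphism
  \<open>h\<close> from \<open>M\<close> to \<open>M'\<close>: the class of \<open>f\<close> goes to the class of \<open>f\<close> composed with the chain map.
\<close>

definition Ext_map ::
  "('a, 'r) ring_scheme \<Rightarrow> nat \<Rightarrow> ('a, 'm, 'x) module_scheme \<Rightarrow> ('a, 'n, 'y) module_scheme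
    \<Rightarrow> ('m \<Rightarrow> 'k) \<Rightarrow> ((('a, 'k) cell \<Rightarrow> 'a) \<Rightarrow> 'n) set \<Rightarrow> ((('a, 'm) cell \<Rightarrow> 'a) \<Rightarrow> 'n) set"
  where
  "Ext_map R i M N h X =
     (\<Union>f \<in> X. coboundaries (ext_complex R M N) (ext_diff R M) i
                +>\<^bsub>ext_complex R M N i\<^esub> (\<lambda>v \<in> carrier (res_module R M i). f (res_map R h v)))"


section \<open>Direct limits of sequences of modules\<close>

text \<open>\<open>dl_trans t m k\<close> is the composite \<open>E\<^sub>m \<rightarrow> E\<^sub>m\<^sub>+\<^sub>k\<close> of transition maps \<open>t n : E\<^sub>n \<rightarrow> E\<^sub>n\<^sub>+\<^sub>1\<close>.\<close>

primrec dl_trans :: "(nat \<Rightarrow> 'e \<Rightarrow> 'e) \<Rightarrow> nat \<Rightarrow> nat \<Rightarrow> 'e \<Rightarrow> 'e"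
  where
  "dl_trans t m 0 x = x"
| "dl_trans t m (Suc k) x = t (m + k) (dl_trans t m k x)"

definition dl_rel ::
  "(nat \<Rightarrow> ('a, 'e, 'x) module_scheme) \<Rightarrow> (nat \<Rightarrow> 'e \<Rightarrow> 'e) \<Rightarrow> ((nat \<times> 'e) \<times> (nat \<times> 'e)) set"
  where
  "dl_rel E t = {((m, x), (n, y)). x \<in> carrier (E m) \<and> y \<in> carrier (E n) \<and>
     (\<exists>k. m \<le> k \<and> n \<le> k \<and> dl_trans t m (k - m) x = dl_trans t n (k - n) y)}"

definition direct_limit ::
  "(nat \<Rightarrow> ('a, 'e, 'x) module_scheme) \<Rightarrow> (nat \<Rightarrow> 'e \<Rightarrow> 'e) \<Rightarrow> ('a, (nat \<times> 'e) set) module"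
  where
  "direct_limit E t =
    \<lparr>carrier = (SIGMA n:UNIV. carrier (E n)) // dl_rel E t,
     monoid.mult = undefined, one = undefined,
     ring.zero = dl_rel E t `` {(0, \<zero>\<^bsub>E 0\<^esub>)},
     add = (\<lambda>X Y. \<Union>(m, x) \<in> X. \<Union>(n, y) \<in> Y.
       dl_rel E t `` {(max m n, dl_trans t m (max m n - m) x
                                 \<oplus>\<^bsub>E (max m n)\<^esub> dl_trans t n (max m n - n) y)}),
     smult = (\<lambda>r X. \<Union>(n, x) \<in> X. dl_rel E t `` {(n, r \<odot>\<^bsub>E n\<^esub> x)})\<rparr>"


section \<open>Generalized local cohomology\<close>

definition power_quotient ::
  "('a, 'r) ring_scheme \<Rightarrow> 'a set \<Rightarrow> ('a, 'm, 'x) module_scheme \<Rightarrow> nat \<Rightarrow> ('a, 'm set) module"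
  where
  "power_quotient R I M n = quotient_module M (ideal_smult R (ideal_power R I n) M)"

definition power_quotient_proj ::
  "('a, 'r) ring_scheme \<Rightarrow> 'a set \<Rightarrow> ('a, 'm, 'x) module_scheme \<Rightarrow> nat \<Rightarrow> 'm set \<Rightarrow> 'm set"
  where
  "power_quotient_proj R I M n X = (\<Union>x \<in> X. ideal_smult R (ideal_power R I n) M +>\<^bsub>M\<^esub> x)"

definition gen_local_cohomology ::
  "('a, 'r) ring_scheme \<Rightarrow> 'a set \<Rightarrow> nat \<Rightarrow> ('a, 'm, 'x) module_scheme \<Rightarrow> ('a, 'n, 'y) module_scheme
    \<Rightarrow> ('a, (nat \<times> ((('a, 'm set) cell \<Rightarrow> 'a) \<Rightarrow> 'n) set) set) module"
  where
  "gen_local_cohomology R I i M N =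
     direct_limit (\<lambda>n. Ext R i (power_quotient R I M n) N)
       (\<lambda>n. Ext_map R i (power_quotient R I M (Suc n)) N (power_quotient_proj R I M n))"


section \<open>Local cohomology and cohomological dimension\<close>

text \<open>
  Injectivity is the extension property along monomorphisms of modules. The test modules
  range over all \<open>R\<close>-modules whose elements are of type \<open>'a\<close>, the type of elements of \<open>R\<close>. These
  include \<open>R\<close> and its ideals, so by Baer's criterion the property then holds for test
  modules of any type.
\<close>

definition injective_module :: "('a, 'r) ring_scheme \<Rightarrow> ('a, 'e, 'x) module_scheme \<Rightarrow> bool"
  where
  "injective_module R E \<longleftrightarrow> Module.module R E \<and>
     (\<forall>(A :: ('a, 'a) module) (B :: ('a, 'a) module) f g.
        Module.module R A \<and> Module.module R B \<and>
        f \<in> mod_hom R A B \<and> inj_on f (carrier A) \<and> g \<in> mod_hom R A E \<longrightarrow>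
        (\<exists>h \<in> mod_hom R B E. \<forall>x \<in> carrier A. h (f x) = g x))"

definition injective_resolution ::
  "('a, 'r) ring_scheme \<Rightarrow> ('a, 'n, 'y) module_scheme
    \<Rightarrow> (nat \<Rightarrow> ('a, 'e) module) \<Rightarrow> (nat \<Rightarrow> 'e \<Rightarrow> 'e) \<Rightarrow> bool"
  where
  "injective_resolution R N E d \<longleftrightarrow>
     (\<forall>i. injective_module R (E i)) \<and>
     (\<forall>i. d i \<in> mod_hom R (E i) (E (Suc i))) \<and>
     (\<exists>\<epsilon> \<in> mod_hom R N (E 0). inj_on \<epsilon> (carrier N) \<and> \<epsilon> ` carrier N = cocycles E d 0) \<and>
     (\<forall>i. d i ` carrier (E i) = cocycles E d (Suc i))"

text \<open>
  \<open>H\<^sup>i\<^sub>I(N)\<close> is the \<open>i\<close>-th right derived functor of the \<open>I\<close>-torsion functor: the cohomology of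
  \<open>\<Gamma>\<^sub>I(E)\<close> for an injective resolution \<open>E\<close> of \<open>N\<close>, which we choose once and for all. The
  element type \<open>'a list \<Rightarrow> 'n \<times> bool\<close> is large enough to contain a resolution of every
  \<open>R\<close>-module \<open>N\<close> on \<open>'n\<close>. Indeed \<open>N\<close> embeds into the injective module \<open>Hom\<^sub>\<int>(R, D)\<close>, where \<open>D\<close>
  is a divisible hull of \<open>N\<close> of cardinality at most \<open>|N| \<cdot> \<aleph>\<^sub>0\<close>. The cardinal \<open>\<mu>\<close> of the above
  type satisfies \<open>|N| \<le> \<mu>\<close>, \<open>\<aleph>\<^sub>0 \<le> \<mu>\<close> and \<open>\<mu> = \<mu>\<^sup>\<lambda>\<close> for \<open>\<lambda> = max(|'a|, \<aleph>\<^sub>0)\<close>, so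
  \<open>Hom\<^sub>\<int>(R, D)\<close>, its quotient by \<open>N\<close>, and inductively all later terms have at most \<open>\<mu>\<close> elements.
\<close>

definition chosen_injective_resolution ::
  "('a, 'r) ring_scheme \<Rightarrow> ('a, 'n, 'y) module_scheme
    \<Rightarrow> (nat \<Rightarrow> ('a, 'a list \<Rightarrow> 'n \<times> bool) module)
       \<times> (nat \<Rightarrow> ('a list \<Rightarrow> 'n \<times> bool) \<Rightarrow> ('a list \<Rightarrow> 'n \<times> bool))"
  where
  "chosen_injective_resolution R N = (SOME (E, d). injective_resolution R N E d)"

definition local_cohomology ::
  "('a, 'r) ring_scheme \<Rightarrow> 'a set \<Rightarrow> nat \<Rightarrow> ('a, 'n, 'y) module_scheme
    \<Rightarrow> ('a, ('a list \<Rightarrow> 'n \<times> bool) set) module"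
  where
  "local_cohomology R I i N =
     (case chosen_injective_resolution R N of
        (E, d) \<Rightarrow> cohomology (\<lambda>j. torsion_module R I (E j)) d i)"

text \<open>
  The supremum of a nonempty set of natural numbers that is bounded above is its largest
  element. The value is \<open>-\<infinity>\<close> if all \<open>H\<^sup>i\<^sub>I(N)\<close> vanish.
\<close>

definition cd :: "('a, 'r) ring_scheme \<Rightarrow> 'a set \<Rightarrow> ('a, 'n, 'y) module_scheme \<Rightarrow> ereal"
  where
  "cd R I N = (SUP i \<in> {i. \<not> is_zero_module (local_cohomology R I i N)}. ereal (real i))"

end

theory Submission
  imports Defs
begin

text \<open>
  A finitely generated \<open>I\<close>-torsion module \<open>M\<close> is annihilated by some \<open>I\<^sup>n\<close>, so the system
  \<open>Ext\<^sup>i(M/I\<^sup>nM, N)\<close> is eventually constant and its limit is a quotient of \<open>Ext\<^sup>i(M, N)\<close>, which is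
  finitely generated. The last point has to be shown for the functorial resolution \<open>F\<close>, whose
  terms are not finitely generated. Over a Noetherian ring, finite subsets \<open>S\<^sub>i\<close> of the bases of
  the \<open>F\<^sub>i\<close> can be chosen that span a subcomplex \<open>G\<close> which is itself a resolution of \<open>M\<close>. Then
  \<open>F/G\<close> is contractible, so a cocycle \<open>F\<^sub>i \<rightarrow> N\<close> vanishing on \<open>G\<^sub>i\<close> is a coboundary. Cocycles modulo
  those vanishing on \<open>G\<^sub>i\<close> embed into the Noetherian module \<open>N\<close> to the power \<open>|S\<^sub>i|\<close>.
\<close>

section \<open>Submodules and homomorphisms\<close>

text \<open>\<open>Hom(F i, N)\<close> is a product of copies of \<open>N\<close>, one for each cell
  in the basis of \<open>F i\<close>; in general it is not Noetherian, so finite generation of its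
  subquotients cannot be inherited. A separate resolution by finite free modules would call for a
  comparison of resolutions, whereas a subcomplex of \<open>F\<close> lets cochains be tested by
  evaluation at finitely many basis vectors. It can be found inside \<open>F\<close> because every
  relation is itself a cell: if the combination \<open>t\<close> of a list \<open>l\<close> lies in
  a kernel, then \<open>Rel l\<close> is a basis element with boundary \<open>t\<close>. Finitely
  many generators of a kernel, written as lists over the cells already chosen, thus give the next
  finite set of cells. The contraction exists because each \<open>F i\<close> is free: it is chosen
  on basis vectors and extended linearly. In the limit, equality replaces isomorphism: for large
  \<open>n\<close> the modules \<open>M/I\<^sup>nM\<close> are one and the same record, and strict
  functoriality turns a map that fixes all elements into the identity of \<open>Ext\<close>.\<close>

lemma (in Module.module) submoduleI':
  assumes "H \<subseteq> carrier M" "\<zero>\<^bsub>M\<^esub> \<in> H"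
    and "\<And>x y. x \<in> H \<Longrightarrow> y \<in> H \<Longrightarrow> x \<oplus>\<^bsub>M\<^esub> y \<in> H"
    and "\<And>a x. a \<in> carrier R \<Longrightarrow> x \<in> H \<Longrightarrow> a \<odot>\<^bsub>M\<^esub> x \<in> H"
  shows "submodule H R M"
proof (rule submoduleI)
  \<comment> \<open>Negation is multiplication by -1, so closure under it comes from closure under
    scalars.\<close>
  fix x assume x: "x \<in> H"
  then have "\<ominus>\<^bsub>M\<^esub> x = (\<ominus> \<one>) \<odot>\<^bsub>M\<^esub> x"
    using assms(1) by (auto simp: smult_l_minus)
  then show "\<ominus>\<^bsub>M\<^esub> x \<in> H"
    using assms(4) x by simp
qed (use assms in auto)

lemma submodule_zero_closed: "submodule H R M \<Longrightarrow> \<zero>\<^bsub>M\<^esub> \<in> H"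
  using subgroup.one_closed[OF submodule.axioms(1)] by fastforce

lemma (in Module.module) submodule_gen:
  assumes "S \<subseteq> carrier M"
  shows "submodule (gen_submodule R M S) R M"
  using carrier_is_submodule assms
  by (intro submoduleI')
    (auto simp: gen_submodule_def submodule_zero_closed submoduleE(4,5))

lemma gen_submodule_incl: "S \<subseteq> gen_submodule R M S"
  by (auto simp: gen_submodule_def)

lemma gen_submodule_least: "submodule H R M \<Longrightarrow> S \<subseteq> H \<Longrightarrow> gen_submodule R M S \<subseteq> H"
  by (auto simp: gen_submodule_def)

lemma gen_submodule_mono: "S \<subseteq> T \<Longrightarrow> gen_submodule R M S \<subseteq> gen_submodule R M T"
  by (auto simp: gen_submodule_def)

lemma mod_homI:
  assumes "\<And>x. x \<in> carrier A \<Longrightarrow> f x \<in> carrier B"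
    and "\<And>x y. x \<in> carrier A \<Longrightarrow> y \<in> carrier A \<Longrightarrow> f (x \<oplus>\<^bsub>A\<^esub> y) = f x \<oplus>\<^bsub>B\<^esub> f y"
    and "\<And>r x. r \<in> carrier R \<Longrightarrow> x \<in> carrier A \<Longrightarrow> f (r \<odot>\<^bsub>A\<^esub> x) = r \<odot>\<^bsub>B\<^esub> f x"
  shows "f \<in> mod_hom R A B"
  using assms by (auto simp: mod_hom_def)

lemma
  assumes "f \<in> mod_hom R A B"
  shows mod_hom_closed: "x \<in> carrier A \<Longrightarrow> f x \<in> carrier B"
    and mod_hom_add: "x \<in> carrier A \<Longrightarrow> y \<in> carrier A \<Longrightarrow> f (x \<oplus>\<^bsub>A\<^esub> y) = f x \<oplus>\<^bsub>B\<^esub> f y"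
    and mod_hom_smult: "r \<in> carrier R \<Longrightarrow> x \<in> carrier A \<Longrightarrow> f (r \<odot>\<^bsub>A\<^esub> x) = r \<odot>\<^bsub>B\<^esub> f x"
  using assms by (auto simp: mod_hom_def)

lemma mod_hom_comp: "f \<in> mod_hom R A B \<Longrightarrow> g \<in> mod_hom R B C \<Longrightarrow> (\<lambda>x. g (f x)) \<in> mod_hom R A C"
  unfolding mod_hom_def by (auto simp: Pi_iff)

lemma mod_hom_zero:
  assumes "Module.module R A" "Module.module R B" "f \<in> mod_hom R A B"
  shows "f \<zero>\<^bsub>A\<^esub> = \<zero>\<^bsub>B\<^esub>"
proof -
  interpret A: Module.module R A by fact
  interpret B: Module.module R B by fact
  have "f \<zero>\<^bsub>A\<^esub> \<oplus>\<^bsub>B\<^esub> f \<zero>\<^bsub>A\<^esub> = f \<zero>\<^bsub>A\<^esub>"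
    using mod_hom_add[OF assms(3), of "\<zero>\<^bsub>A\<^esub>" "\<zero>\<^bsub>A\<^esub>"] by simp
  then show ?thesis
    using mod_hom_closed[OF assms(3), of "\<zero>\<^bsub>A\<^esub>"] by (metis A.zero_closed B.add.r_cancel_one')
qed

text \<open>The submodule \<open>Z\<close> limits the domain, so that one lemma covers preimages,
  kernels (with \<open>H\<close> zero) and the part of \<open>Z\<close> killed by
  \<open>f\<close>.\<close>

lemma submodule_vimage:
  assumes "Module.module R A" "Module.module R B" "f \<in> mod_hom R A B"
    and "submodule H R B" "submodule Z R A"
  shows "submodule {x \<in> Z. f x \<in> H} R A"
proof -
  interpret A: Module.module R A by fact
  interpret B: Module.module R B by fact
  note Z = A.submoduleE[OF assms(5)] and H = B.submoduleE[OF assms(4)]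
  show ?thesis
    using Z(1)
    by (intro A.submoduleI')
      (auto simp: mod_hom_add[OF assms(3)] mod_hom_smult[OF assms(3)] mod_hom_zero[OF assms(1-3)]
        submodule_zero_closed[OF assms(4)] submodule_zero_closed[OF assms(5)] Z(4,5) H(4,5) subset_iff)
qed

lemma submodule_image:
  assumes "Module.module R A" "Module.module R B" "f \<in> mod_hom R A B" "submodule Z R A"
  shows "submodule (f ` Z) R B"
proof -
  interpret A: Module.module R A by fact
  interpret B: Module.module R B by fact
  note Z = A.submoduleE[OF assms(4)]
  show ?thesis
  proof (rule B.submoduleI')
    show "f ` Z \<subseteq> carrier B"
      using Z(1) mod_hom_closed[OF assms(3)] by auto
    show "\<zero>\<^bsub>B\<^esub> \<in> f ` Z"
      using submodule_zero_closed[OF assms(4)] mod_hom_zero[OF assms(1-3)] by force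
  next
    fix x y assume "x \<in> f ` Z" "y \<in> f ` Z"
    then obtain u v where uv: "x = f u" "y = f v" "u \<in> Z" "v \<in> Z" by auto
    then have "x \<oplus>\<^bsub>B\<^esub> y = f (u \<oplus>\<^bsub>A\<^esub> v)"
      using Z(1) by (simp add: mod_hom_add[OF assms(3)] subset_iff)
    then show "x \<oplus>\<^bsub>B\<^esub> y \<in> f ` Z"
      using uv Z(5) by blast
  next
    fix a x assume a: "a \<in> carrier R" and "x \<in> f ` Z"
    then obtain u where u: "x = f u" "u \<in> Z" by auto
    then have "a \<odot>\<^bsub>B\<^esub> x = f (a \<odot>\<^bsub>A\<^esub> u)"
      using Z(1) a by (simp add: mod_hom_smult[OF assms(3)] subset_iff)
    then show "a \<odot>\<^bsub>B\<^esub> x \<in> f ` Z"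
      using u a Z(4) by blast
  qed
qed

lemma gen_submodule_image:
  assumes "Module.module R A" "Module.module R B" "f \<in> mod_hom R A B" "S \<subseteq> carrier A"
  shows "gen_submodule R B (f ` S) = f ` gen_submodule R A S"
proof
  interpret A: Module.module R A by fact
  interpret B: Module.module R B by fact
  have fS: "f ` S \<subseteq> carrier B"
    using assms(4) mod_hom_closed[OF assms(3)] by auto
  show "gen_submodule R B (f ` S) \<subseteq> f ` gen_submodule R A S"
    using A.submodule_gen[OF assms(4)] submodule_image[OF assms(1-3)]
    by (intro gen_submodule_least) (auto simp: gen_submodule_incl image_mono)
  have "gen_submodule R A S \<subseteq> {x \<in> carrier A. f x \<in> gen_submodule R B (f ` S)}"
  proof (rule gen_submodule_least)
    show "submodule {x \<in> carrier A. f x \<in> gen_submodule R B (f ` S)} R A"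
      by (rule submodule_vimage[OF assms(1-3) B.submodule_gen[OF fS] A.carrier_is_submodule])
    show "S \<subseteq> {x \<in> carrier A. f x \<in> gen_submodule R B (f ` S)}"
      using assms(4) gen_submodule_incl[of "f ` S" R B] by auto
  qed
  then show "f ` gen_submodule R A S \<subseteq> gen_submodule R B (f ` S)"
    by auto
qed

text \<open>Every element of \<open>B\<close> lifts to \<open>A\<close>, and so do the module laws;
  nothing about \<open>B\<close> has to be known beforehand. Quotients and direct limits, whose
  operations are unions over representatives, become modules in this way. The last hypothesis ties
  the record field for zero to the addition.\<close>

lemma module_surj_image:
  assumes "Module.module R A" and hom: "f \<in> mod_hom R A B"
    and surj: "f ` carrier A = carrier B" and zero: "f \<zero>\<^bsub>A\<^esub> = \<zero>\<^bsub>B\<^esub>"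
  shows "Module.module R B"
proof -
  interpret A: Module.module R A by fact
  note f = mod_hom_add[OF hom, symmetric] mod_hom_smult[OF hom, symmetric] zero[symmetric]
  show ?thesis
  proof (intro moduleI abelian_groupI; (unfold surj[symmetric])?)
    fix x assume "x \<in> f ` carrier A"
    then obtain u where u: "u \<in> carrier A" "x = f u" by auto
    then have "f (\<ominus>\<^bsub>A\<^esub> u) \<oplus>\<^bsub>B\<^esub> x = \<zero>\<^bsub>B\<^esub>"
      by (simp add: f A.M.l_neg)
    then show "\<exists>y\<in>f ` carrier A. y \<oplus>\<^bsub>B\<^esub> x = \<zero>\<^bsub>B\<^esub>"
      using u by blast
  next
    fix x y assume "x \<in> f ` carrier A" "y \<in> f ` carrier A"
    then show "x \<oplus>\<^bsub>B\<^esub> y = y \<oplus>\<^bsub>B\<^esub> x"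
      by (auto simp: f A.M.a_comm)
  next
    fix x y z assume "x \<in> f ` carrier A" "y \<in> f ` carrier A" "z \<in> f ` carrier A"
    then show "x \<oplus>\<^bsub>B\<^esub> y \<oplus>\<^bsub>B\<^esub> z = x \<oplus>\<^bsub>B\<^esub> (y \<oplus>\<^bsub>B\<^esub> z)"
      by (auto simp: f A.M.a_assoc)
  qed (auto simp: f A.smult_l_distr A.smult_r_distr A.smult_assoc1 A.R.cring_axioms)
qed

lemma fg_surj_image:
  assumes "fg_module R A" and hom: "f \<in> mod_hom R A B"
    and surj: "f ` carrier A = carrier B" and zero: "f \<zero>\<^bsub>A\<^esub> = \<zero>\<^bsub>B\<^esub>"
  shows "fg_module R B"
proof -
  have A: "Module.module R A" and "\<exists>S. finite S \<and> S \<subseteq> carrier A \<and> gen_submodule R A S = carrier A"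
    using assms(1) by (auto simp: fg_module_def)
  then obtain S where S: "finite S" "S \<subseteq> carrier A" "gen_submodule R A S = carrier A" by auto
  have B: "Module.module R B"
    using module_surj_image[OF A hom surj zero] .
  have "gen_submodule R B (f ` S) = carrier B"
    using gen_submodule_image[OF A B hom S(2)] S(3) surj by simp
  moreover have "f ` S \<subseteq> carrier B" using S(2) surj by blast
  ultimately show ?thesis
    using B S(1) unfolding fg_module_def by blast
qed

lemma restrict_module:
  assumes "Module.module R M" "submodule H R M"
  shows "Module.module R (M\<lparr>carrier := H\<rparr>)"
  using submodule.submodule_is_module[OF assms(2,1)] .

section \<open>Noetherian modules\<close>

definition noetherian_module :: "('a, 'r) ring_scheme \<Rightarrow> ('a, 'm, 'x) module_scheme \<Rightarrow> bool"
  where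
  "noetherian_module R M \<longleftrightarrow> Module.module R M \<and>
     (\<forall>H. submodule H R M \<longrightarrow> (\<exists>T. finite T \<and> T \<subseteq> H \<and> gen_submodule R M T = H))"

lemma noetherian_moduleE:
  assumes "noetherian_module R M" "submodule H R M"
  obtains T where "finite T" "T \<subseteq> H" "gen_submodule R M T = H"
  using assms by (auto simp: noetherian_module_def)

text \<open>Here \<open>P\<close> itself may be far from Noetherian. Induction on \<open>S\<close>:
  the image of \<open>Z\<close> under \<open>\<rho> b\<close> is a submodule of \<open>N\<close>,
  finitely many generators of it lift to \<open>Z\<close>, and an element of \<open>Z\<close> minus
  a suitable combination of the lifts is killed by \<open>\<rho> b\<close>. The induction hypothesis
  for the submodule of such elements does the rest, which is why \<open>Z\<close> is arbitrary. The
  maps will be the coordinates of a free module, and later evaluations of cocycles.\<close>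

lemma noetherian_decomposition:
  assumes P: "Module.module R P" and N: "noetherian_module R N"
    and "finite S" "\<And>b. b \<in> S \<Longrightarrow> \<rho> b \<in> mod_hom R P N" "submodule Z R P"
  shows "\<exists>T. finite T \<and> T \<subseteq> Z \<and>
    (\<forall>z\<in>Z. \<exists>t\<in>gen_submodule R P T. \<exists>k\<in>Z. (\<forall>b\<in>S. \<rho> b k = \<zero>\<^bsub>N\<^esub>) \<and> z = t \<oplus>\<^bsub>P\<^esub> k)"
  using assms(3-5)
proof (induction S arbitrary: Z rule: finite_induct)
  case empty
  interpret P: Module.module R P by fact
  show ?case
  proof (intro exI[of _ "{}"] conjI ballI)
    fix z assume "z \<in> Z"
    moreover have "\<zero>\<^bsub>P\<^esub> \<in> gen_submodule R P {}"
      by (rule submodule_zero_closed[OF P.submodule_gen]) simp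
    ultimately show "\<exists>t\<in>gen_submodule R P {}. \<exists>k\<in>Z. (\<forall>b\<in>{}. \<rho> b k = \<zero>\<^bsub>N\<^esub>) \<and> z = t \<oplus>\<^bsub>P\<^esub> k"
      using P.submoduleE(1)[OF empty.prems(2)] by (intro bexI[of _ "\<zero>\<^bsub>P\<^esub>"] bexI[of _ z]) auto
  qed auto
next
  case (insert b S)
  interpret P: Module.module R P by fact
  have Nm: "Module.module R N" using N by (simp add: noetherian_module_def)
  interpret N: Module.module R N by fact
  note Z = P.submoduleE[OF insert.prems(2)]
  have \<rho>: "\<rho> b \<in> mod_hom R P N" using insert.prems by simp
  obtain T0' where T0': "finite T0'" "T0' \<subseteq> \<rho> b ` Z" "gen_submodule R N T0' = \<rho> b ` Z"
    using noetherian_moduleE[OF N submodule_image[OF P Nm \<rho> insert.prems(2)]] .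
  then obtain T0 where T0: "finite T0" "T0 \<subseteq> Z" "T0' = \<rho> b ` T0"
    by (meson finite_subset_image)
  have T0c: "T0 \<subseteq> carrier P" using T0 Z by blast
  define Z' where "Z' = {z \<in> Z. \<rho> b z \<in> {\<zero>\<^bsub>N\<^esub>}}"
  have sub0: "submodule {\<zero>\<^bsub>N\<^esub>} R N"
    by (rule N.submoduleI') auto
  have Z': "submodule Z' R P"
    unfolding Z'_def by (rule submodule_vimage[OF P Nm \<rho> sub0 insert.prems(2)])
  obtain T1 where T1: "finite T1" "T1 \<subseteq> Z'"
      "\<And>z. z \<in> Z' \<Longrightarrow> \<exists>t\<in>gen_submodule R P T1. \<exists>k\<in>Z'. (\<forall>b\<in>S. \<rho> b k = \<zero>\<^bsub>N\<^esub>) \<and> z = t \<oplus>\<^bsub>P\<^esub> k"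
    using insert.IH[OF insert.prems(1)[OF insertI2] Z'] by auto
  have T01c: "T0 \<union> T1 \<subseteq> carrier P" using T0c T1(2) Z(1) by (auto simp: Z'_def)
  show ?case
  proof (intro exI[of _ "T0 \<union> T1"] conjI ballI)
    fix z assume z: "z \<in> Z"
    then have "\<rho> b z \<in> \<rho> b ` gen_submodule R P T0"
      using T0' T0(3) gen_submodule_image[OF P Nm \<rho> T0c] by simp
    then obtain t0 where t0: "t0 \<in> gen_submodule R P T0" "\<rho> b t0 = \<rho> b z" by auto
    have t0Z: "t0 \<in> Z"
      using t0 gen_submodule_least[OF insert.prems(2) T0(2)] by blast
    \<comment> \<open>The remainder is killed by \<open>\<rho> b\<close>. Splitting it inside
      \<open>Z'\<close> leaves a \<open>k\<close> in \<open>Z'\<close>, hence still killed by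
      \<open>\<rho> b\<close>.\<close>
    define z' where "z' = \<ominus>\<^bsub>P\<^esub> t0 \<oplus>\<^bsub>P\<^esub> z"
    have c: "z \<in> carrier P" "t0 \<in> carrier P" using z t0Z Z by auto
    then have zz: "z = t0 \<oplus>\<^bsub>P\<^esub> z'"
      by (simp add: z'_def P.M.r_neg2)
    have z'Z: "z' \<in> Z" unfolding z'_def using z t0Z Z by simp
    then have "z' \<in> carrier P" using Z by auto
    have "\<rho> b z = \<rho> b t0 \<oplus>\<^bsub>N\<^esub> \<rho> b z'"
      using \<open>z' \<in> carrier P\<close> c mod_hom_add[OF \<rho>] zz by metis
    then have "\<rho> b z' = \<zero>\<^bsub>N\<^esub>"
      using t0(2) c \<open>z' \<in> carrier P\<close> mod_hom_closed[OF \<rho>]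
        N.M.add.l_cancel_one'[of "\<rho> b z'" "\<rho> b z"] by simp
    then have "z' \<in> Z'" using z'Z by (simp add: Z'_def)
    then obtain t1 k where t1: "t1 \<in> gen_submodule R P T1" "k \<in> Z'" "\<forall>b\<in>S. \<rho> b k = \<zero>\<^bsub>N\<^esub>" "z' = t1 \<oplus>\<^bsub>P\<^esub> k"
      using T1(3) by blast
    note G = P.submoduleE[OF P.submodule_gen[OF T01c]]
    have tg: "t0 \<in> gen_submodule R P (T0 \<union> T1)" "t1 \<in> gen_submodule R P (T0 \<union> T1)"
      using t0 t1 gen_submodule_mono[of T0 "T0 \<union> T1" R P] gen_submodule_mono[of T1 "T0 \<union> T1" R P] by auto
    show "\<exists>t\<in>gen_submodule R P (T0 \<union> T1). \<exists>k\<in>Z. (\<forall>b\<in>insert b S. \<rho> b k = \<zero>\<^bsub>N\<^esub>) \<and> z = t \<oplus>\<^bsub>P\<^esub> k"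
    proof (intro bexI conjI)
      show "t0 \<oplus>\<^bsub>P\<^esub> t1 \<in> gen_submodule R P (T0 \<union> T1)" using tg G(5) by blast
      show "k \<in> Z" using t1 Z'_def by blast
      then have "k \<in> carrier P" "t1 \<in> carrier P" using Z G tg by auto
      then show "z = t0 \<oplus>\<^bsub>P\<^esub> t1 \<oplus>\<^bsub>P\<^esub> k"
        using zz t1(4) c by (simp add: P.M.a_assoc)
      show "\<forall>b\<in>insert b S. \<rho> b k = \<zero>\<^bsub>N\<^esub>" using t1 Z'_def by auto
    qed
  qed (use T0 T1 Z'_def in auto)
qed

section \<open>Free modules\<close>

definition delta :: "('a, 'r) ring_scheme \<Rightarrow> 'b \<Rightarrow> 'b \<Rightarrow> 'a"
  where "delta R c = (\<lambda>b. if c = b then \<one>\<^bsub>R\<^esub> else \<zero>\<^bsub>R\<^esub>)"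

text \<open>The linear extension of \<open>\<phi>\<close>. Summing over the support of
  \<open>v\<close> keeps the basis out of the term, so the same expression serves a free module and
  its submodules spanned by fewer basis elements.\<close>

definition free_ext ::
  "('a, 'r) ring_scheme \<Rightarrow> ('a, 'p, 'x) module_scheme \<Rightarrow> ('b \<Rightarrow> 'p) \<Rightarrow> ('b \<Rightarrow> 'a) \<Rightarrow> 'p"
  where "free_ext R P \<phi> v = (\<Oplus>\<^bsub>P\<^esub>c \<in> {c. v c \<noteq> \<zero>\<^bsub>R\<^esub>}. v c \<odot>\<^bsub>P\<^esub> \<phi> c)"

lemma free_module_simps [simp]:
  "\<zero>\<^bsub>free_module R B\<^esub> = (\<lambda>_. \<zero>\<^bsub>R\<^esub>)"
  "v \<oplus>\<^bsub>free_module R B\<^esub> w = (\<lambda>b. v b \<oplus>\<^bsub>R\<^esub> w b)"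
  "r \<odot>\<^bsub>free_module R B\<^esub> v = (\<lambda>b. r \<otimes>\<^bsub>R\<^esub> v b)"
  by (auto simp: free_module_def)

lemma free_module_carrier_iff:
  "v \<in> carrier (free_module R B) \<longleftrightarrow>
    (\<forall>b. v b \<in> carrier R) \<and> finite {b. v b \<noteq> \<zero>\<^bsub>R\<^esub>} \<and> (\<forall>b. b \<notin> B \<longrightarrow> v b = \<zero>\<^bsub>R\<^esub>)"
  by (auto simp: free_module_def)

lemma free_module_carrier_mono:
  "S \<subseteq> B \<Longrightarrow> v \<in> carrier (free_module R S) \<Longrightarrow> v \<in> carrier (free_module R B)"
  by (auto simp: free_module_carrier_iff)

context cring
begin

lemma free_module_add_closed:
  assumes "v \<in> carrier (free_module R B)" "w \<in> carrier (free_module R B)"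
  shows "(\<lambda>b. v b \<oplus> w b) \<in> carrier (free_module R B)"
proof -
  have "{b. v b \<oplus> w b \<noteq> \<zero>} \<subseteq> {b. v b \<noteq> \<zero>} \<union> {b. w b \<noteq> \<zero>}" by auto
  then have "finite {b. v b \<oplus> w b \<noteq> \<zero>}"
    by (rule finite_subset) (use assms in \<open>auto simp: free_module_carrier_iff\<close>)
  then show ?thesis using assms by (auto simp: free_module_carrier_iff)
qed

lemma free_module_smult_closed:
  assumes "v \<in> carrier (free_module R B)" "r \<in> carrier R"
  shows "(\<lambda>b. r \<otimes> v b) \<in> carrier (free_module R B)"
proof -
  have "{b. r \<otimes> v b \<noteq> \<zero>} \<subseteq> {b. v b \<noteq> \<zero>}" using assms by auto
  then have "finite {b. r \<otimes> v b \<noteq> \<zero>}"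
    by (rule finite_subset) (use assms in \<open>auto simp: free_module_carrier_iff\<close>)
  then show ?thesis using assms by (auto simp: free_module_carrier_iff)
qed

lemma free_module_module: "Module.module R (free_module R B)"
proof (intro moduleI abelian_groupI)
  fix x assume x: "x \<in> carrier (free_module R B)"
  have "(\<lambda>b. (\<ominus> \<one>) \<otimes> x b) \<in> carrier (free_module R B)"
    using x by (intro free_module_smult_closed) auto
  moreover have "(\<lambda>b. (\<ominus> \<one>) \<otimes> x b) \<oplus>\<^bsub>free_module R B\<^esub> x = \<zero>\<^bsub>free_module R B\<^esub>"
    using x by (auto simp: free_module_carrier_iff l_minus l_neg)
  ultimately show "\<exists>y\<in>carrier (free_module R B). y \<oplus>\<^bsub>free_module R B\<^esub> x = \<zero>\<^bsub>free_module R B\<^esub>"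
    by blast
qed (auto intro: cring_axioms free_module_add_closed free_module_smult_closed,
    auto simp: free_module_carrier_iff a_ac m_assoc l_distr r_distr)

lemma delta_closed: "c \<in> B \<Longrightarrow> delta R c \<in> carrier (free_module R B)"
  by (auto simp: free_module_carrier_iff delta_def)

text \<open>Induction on the finite support: one nonzero coordinate is set to zero and put back as a
  multiple of \<open>delta R c\<close>.\<close>

lemma free_module_induct [consumes 1, case_names zero add]:
  assumes "v \<in> carrier (free_module R B)"
    and zero: "P (\<lambda>_. \<zero>)"
    and add: "\<And>v r c. v \<in> carrier (free_module R B) \<Longrightarrow> P v \<Longrightarrow> r \<in> carrier R \<Longrightarrow> c \<in> B
      \<Longrightarrow> P (\<lambda>b. r \<otimes> delta R c b \<oplus> v b)"
  shows "P v"
proof -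
  have "finite {b. v b \<noteq> \<zero>}" using assms(1) by (simp add: free_module_carrier_iff)
  then show ?thesis using assms(1)
  proof (induction "{b. v b \<noteq> \<zero>}" arbitrary: v rule: finite_induct)
    case empty
    then have "v = (\<lambda>_. \<zero>)" by auto
    then show ?case using zero by simp
  next
    case (insert c S)
    define w where "w = v(c := \<zero>)"
    have wS: "{b. w b \<noteq> \<zero>} = S" using insert.hyps(2,4) by (auto simp: w_def)
    have v: "\<And>b. v b \<in> carrier R" and c: "c \<in> B"
      using insert.prems insert.hyps(4) by (auto simp: free_module_carrier_iff)
    have w: "w \<in> carrier (free_module R B)"
      using insert.prems insert.hyps(1) wS by (auto simp: free_module_carrier_iff w_def)
    have "P (\<lambda>b. v c \<otimes> delta R c b \<oplus> w b)"
      using insert.hyps(3)[OF wS[symmetric] w] w v c by (intro add) auto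
    moreover have "(\<lambda>b. v c \<otimes> delta R c b \<oplus> w b) = v"
      using v by (auto simp: w_def delta_def fun_eq_iff)
    ultimately show ?case by simp
  qed
qed

text \<open>Reduces a claim to basis vectors whenever the vectors satisfying it form a submodule. It
  will show that boundaries are cycles, that a cochain vanishes on a subcomplex, and that a
  congruence holds.\<close>

lemma free_module_hom_in_submodule:
  assumes P: "Module.module R P" and f: "f \<in> mod_hom R (free_module R B) P"
    and H: "submodule H R P" and "\<And>b. b \<in> B \<Longrightarrow> f (delta R b) \<in> H"
    and "v \<in> carrier (free_module R B)"
  shows "f v \<in> H"
  using assms(5)
proof (induction rule: free_module_induct)
  case zero
  then show ?case
    using mod_hom_zero[OF free_module_module P f] submodule_zero_closed[OF H] by simp
next
  case (add v r c)
  interpret P: Module.module R P by fact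
  have "f (\<lambda>b. r \<otimes> delta R c b \<oplus> v b) = r \<odot>\<^bsub>P\<^esub> f (delta R c) \<oplus>\<^bsub>P\<^esub> f v"
    using mod_hom_add[OF f, of "\<lambda>b. r \<otimes> delta R c b" v] mod_hom_smult[OF f, of r "delta R c"] add
    by (simp add: delta_closed free_module_smult_closed)
  then show ?case
    using add assms(4) P.submoduleE(4,5)[OF H] by simp
qed

lemma free_module_hom_eqI:
  assumes P: "Module.module R P"
    and f: "f \<in> mod_hom R (free_module R B) P" and g: "g \<in> mod_hom R (free_module R B) P"
    and "\<And>b. b \<in> B \<Longrightarrow> f (delta R b) = g (delta R b)"
    and "v \<in> carrier (free_module R B)"
  shows "f v = g v"
  using assms(5)
proof (induction rule: free_module_induct)
  case zero
  then show ?case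
    using mod_hom_zero[OF free_module_module P f] mod_hom_zero[OF free_module_module P g] by simp
next
  case (add v r c)
  show ?case
    using mod_hom_add[OF f, of "\<lambda>b. r \<otimes> delta R c b" v] mod_hom_smult[OF f, of r "delta R c"]
      mod_hom_add[OF g, of "\<lambda>b. r \<otimes> delta R c b" v] mod_hom_smult[OF g, of r "delta R c"] add assms(4)
    by (simp add: delta_closed free_module_smult_closed)
qed

text \<open>Additivity involves sums over three different supports; padding with zero terms brings
  them to a common index set.\<close>

lemma free_ext_superset:
  assumes "Module.module R P" "finite A" "{c. v c \<noteq> \<zero>} \<subseteq> A"
    "\<And>c. c \<in> A \<Longrightarrow> v c \<in> carrier R" "\<And>c. c \<in> A \<Longrightarrow> \<phi> c \<in> carrier P"
  shows "free_ext R P \<phi> v = (\<Oplus>\<^bsub>P\<^esub>c \<in> A. v c \<odot>\<^bsub>P\<^esub> \<phi> c)"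
proof -
  interpret P: Module.module R P by fact
  show ?thesis
    unfolding free_ext_def
    using assms by (intro P.M.add.finprod_mono_neutral_cong_left) auto
qed

lemma free_ext_hom:
  assumes P: "Module.module R P" and \<phi>: "\<And>b. b \<in> B \<Longrightarrow> \<phi> b \<in> carrier P"
  shows "free_ext R P \<phi> \<in> mod_hom R (free_module R B) P"
proof (rule mod_homI)
  interpret P: Module.module R P by fact
  fix x assume x: "x \<in> carrier (free_module R B)"
  then show "free_ext R P \<phi> x \<in> carrier P"
    using \<phi> by (auto simp: free_ext_def free_module_carrier_iff intro!: P.M.finsum_closed)
  have xs: "finite {c. x c \<noteq> \<zero>}" "\<And>c. x c \<in> carrier R" "{c. x c \<noteq> \<zero>} \<subseteq> B"
    using x by (auto simp: free_module_carrier_iff)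
  { fix y assume y: "y \<in> carrier (free_module R B)"
    have ys: "finite {c. y c \<noteq> \<zero>}" "\<And>c. y c \<in> carrier R" "{c. y c \<noteq> \<zero>} \<subseteq> B"
      using y by (auto simp: free_module_carrier_iff)
    let ?A = "{c. x c \<noteq> \<zero>} \<union> {c. y c \<noteq> \<zero>}"
    have AB: "\<And>c. c \<in> ?A \<Longrightarrow> \<phi> c \<in> carrier P" using xs ys \<phi> by auto
    have "free_ext R P \<phi> (\<lambda>c. x c \<oplus> y c) = (\<Oplus>\<^bsub>P\<^esub>c \<in> ?A. (x c \<oplus> y c) \<odot>\<^bsub>P\<^esub> \<phi> c)"
      using xs ys AB by (intro free_ext_superset P) auto
    also have "\<dots> = (\<Oplus>\<^bsub>P\<^esub>c \<in> ?A. x c \<odot>\<^bsub>P\<^esub> \<phi> c \<oplus>\<^bsub>P\<^esub> y c \<odot>\<^bsub>P\<^esub> \<phi> c)"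
      using xs ys AB by (intro P.M.finsum_cong') (auto simp: P.smult_l_distr)
    also have "\<dots> = (\<Oplus>\<^bsub>P\<^esub>c \<in> ?A. x c \<odot>\<^bsub>P\<^esub> \<phi> c) \<oplus>\<^bsub>P\<^esub> (\<Oplus>\<^bsub>P\<^esub>c \<in> ?A. y c \<odot>\<^bsub>P\<^esub> \<phi> c)"
      using xs ys AB by (intro P.M.finsum_addf) auto
    also have "(\<Oplus>\<^bsub>P\<^esub>c \<in> ?A. x c \<odot>\<^bsub>P\<^esub> \<phi> c) = free_ext R P \<phi> x"
      using xs ys AB by (intro free_ext_superset[symmetric] P) auto
    also have "(\<Oplus>\<^bsub>P\<^esub>c \<in> ?A. y c \<odot>\<^bsub>P\<^esub> \<phi> c) = free_ext R P \<phi> y"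
      using xs ys AB by (intro free_ext_superset[symmetric] P) auto
    finally show "free_ext R P \<phi> (x \<oplus>\<^bsub>free_module R B\<^esub> y) = free_ext R P \<phi> x \<oplus>\<^bsub>P\<^esub> free_ext R P \<phi> y"
      by simp }
  { fix r assume r: "r \<in> carrier R"
    let ?A = "{c. x c \<noteq> \<zero>}"
    have AB: "\<And>c. c \<in> ?A \<Longrightarrow> \<phi> c \<in> carrier P" using xs \<phi> by auto
    have "free_ext R P \<phi> (\<lambda>c. r \<otimes> x c) = (\<Oplus>\<^bsub>P\<^esub>c \<in> ?A. (r \<otimes> x c) \<odot>\<^bsub>P\<^esub> \<phi> c)"
      using xs AB r by (intro free_ext_superset P) auto
    also have "\<dots> = (\<Oplus>\<^bsub>P\<^esub>c \<in> ?A. r \<odot>\<^bsub>P\<^esub> (x c \<odot>\<^bsub>P\<^esub> \<phi> c))"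
      using xs r AB by (intro P.M.finsum_cong') (auto simp: P.smult_assoc1)
    also have "\<dots> = r \<odot>\<^bsub>P\<^esub> free_ext R P \<phi> x"
      unfolding free_ext_def using xs AB r by (intro P.finsum_smult_ldistr[symmetric]) auto
    finally show "free_ext R P \<phi> (r \<odot>\<^bsub>free_module R B\<^esub> x) = r \<odot>\<^bsub>P\<^esub> free_ext R P \<phi> x"
      by simp }
qed

lemma free_ext_delta:
  assumes "Module.module R P" "\<phi> c \<in> carrier P"
  shows "free_ext R P \<phi> (delta R c) = \<phi> c"
proof -
  interpret P: Module.module R P by fact
  have "free_ext R P \<phi> (delta R c) = (\<Oplus>\<^bsub>P\<^esub>d \<in> {c}. delta R c d \<odot>\<^bsub>P\<^esub> \<phi> d)"
    using assms by (intro free_ext_superset) (auto simp: delta_def)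
  then show ?thesis using assms(2) by (simp add: delta_def)
qed

text \<open>Translates generation by a family into surjectivity of a map from a free module. It is
  applied to generators of \<open>N\<close>, of \<open>M\<close>, and of the kernels in the
  resolution.\<close>

lemma free_ext_image:
  assumes P: "Module.module R P" and \<phi>: "\<And>b. b \<in> B \<Longrightarrow> \<phi> b \<in> carrier P"
  shows "free_ext R P \<phi> ` carrier (free_module R B) = gen_submodule R P (\<phi> ` B)"
proof
  interpret P: Module.module R P by fact
  note hom = free_ext_hom[OF P, of B \<phi>, OF \<phi>]
  have "\<phi> ` B \<subseteq> carrier P" using \<phi> by auto
  then show "free_ext R P \<phi> ` carrier (free_module R B) \<subseteq> gen_submodule R P (\<phi> ` B)"
    using free_module_hom_in_submodule[OF P hom P.submodule_gen[of "\<phi> ` B"]]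
      gen_submodule_incl[of "\<phi> ` B" R P]
    by (auto simp: free_ext_delta[of P \<phi>] P \<phi> image_subset_iff)
  have F: "submodule (carrier (free_module R B)) R (free_module R B)"
    using Module.module.carrier_is_submodule[OF free_module_module] .
  show "gen_submodule R P (\<phi> ` B) \<subseteq> free_ext R P \<phi> ` carrier (free_module R B)"
  proof (rule gen_submodule_least[OF submodule_image[OF free_module_module P hom F]])
    show "\<phi> ` B \<subseteq> free_ext R P \<phi> ` carrier (free_module R B)"
    proof (rule image_subsetI)
      fix b assume b: "b \<in> B"
      show "\<phi> b \<in> free_ext R P \<phi> ` carrier (free_module R B)"
        by (rule image_eqI[OF _ delta_closed[OF b]]) (simp add: free_ext_delta P \<phi> b)
    qed
  qed simp_all
qed

text \<open>Evaluation at \<open>b\<close> is additive. This links \<open>res_diff\<close> and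
  \<open>res_map\<close>, given cell by cell as sums in \<open>R\<close>, to
  \<open>free_ext\<close>, a sum in the free module.\<close>

lemma finsum_free_module:
  assumes "finite A" "\<And>a. a \<in> A \<Longrightarrow> f a \<in> carrier (free_module R B)"
  shows "(\<Oplus>\<^bsub>free_module R B\<^esub>a \<in> A. f a) b = (\<Oplus>a \<in> A. f a b)"
  using assms
proof (induction A rule: finite_induct)
  case empty
  interpret F: Module.module R "free_module R B" by (rule free_module_module)
  show ?case by simp
next
  case (insert a A)
  interpret F: Module.module R "free_module R B" by (rule free_module_module)
  show ?case
    using insert by (subst F.M.finsum_insert finsum_insert; auto simp: free_module_carrier_iff)+
qed

end

section \<open>Finitely generated modules over Noetherian rings\<close>

definition regular_module :: "('a, 'r) ring_scheme \<Rightarrow> ('a, 'a) module"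
  where
  "regular_module R = \<lparr>carrier = carrier R, monoid.mult = undefined, one = undefined,
     ring.zero = \<zero>\<^bsub>R\<^esub>, add = add R, smult = monoid.mult R\<rparr>"

lemma regular_module_simps [simp]:
  "carrier (regular_module R) = carrier R"
  "\<zero>\<^bsub>regular_module R\<^esub> = \<zero>\<^bsub>R\<^esub>"
  "x \<oplus>\<^bsub>regular_module R\<^esub> y = x \<oplus>\<^bsub>R\<^esub> y"
  "r \<odot>\<^bsub>regular_module R\<^esub> y = r \<otimes>\<^bsub>R\<^esub> y"
  by (auto simp: regular_module_def)

lemma (in cring) regular_module_module: "Module.module R (regular_module R)"
proof (intro moduleI abelian_groupI)
  fix x assume "x \<in> carrier (regular_module R)"
  then show "\<exists>y\<in>carrier (regular_module R). y \<oplus>\<^bsub>regular_module R\<^esub> x = \<zero>\<^bsub>regular_module R\<^esub>"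
    by (auto intro: bexI[of _ "\<ominus> x"] simp: l_neg)
qed (auto simp: a_ac m_assoc l_distr r_distr cring_axioms)

lemma submodule_regular_iff:
  fixes R (structure)
  assumes "cring R"
  shows "submodule H R (regular_module R) \<longleftrightarrow> ideal H R"
proof
  interpret cring R by fact
  interpret N: Module.module R "regular_module R" by (rule regular_module_module)
  { assume "submodule H R (regular_module R)"
    note H = N.submoduleE[OF this] submodule_zero_closed[OF this]
    have "H \<subseteq> carrier R" using H(1) by simp
    moreover have "\<ominus> x \<in> H" if "x \<in> H" for x
      using H(4)[of "\<ominus> \<one>" x] that \<open>H \<subseteq> carrier R\<close> by (auto simp: l_minus subset_iff)
    moreover have "a \<otimes> x \<in> H" if "a \<in> H" "x \<in> carrier R" for a x
      using H(4)[of x a] that \<open>H \<subseteq> carrier R\<close> by (auto simp: m_comm subset_iff)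
    ultimately show "ideal H R"
      using H(4,5,7)
      by (intro idealI ring_axioms add.subgroupI) auto }
  assume "ideal H R"
  then interpret I: ideal H R .
  show "submodule H R (regular_module R)"
    by (rule N.submoduleI') (auto simp: I.I_l_closed)
qed

context
  fixes R :: "('a, 'r) ring_scheme" (structure)
  assumes cring: "cring R" and noeth: "noetherian_ring R"
begin

interpretation cring R by (rule cring)

lemma regular_module_noetherian: "noetherian_module R (regular_module R)"
  unfolding noetherian_module_def
proof (intro conjI allI impI regular_module_module)
  fix H assume "submodule H R (regular_module R)"
  then have H: "ideal H R" by (simp add: submodule_regular_iff[OF cring])
  then obtain T where T: "T \<subseteq> carrier R" "finite T" "H = Idl T"
    using noetherian_ring.finetely_gen[OF noeth] by blast
  have "T \<subseteq> H" using T genideal_self by blast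
  moreover have "gen_submodule R (regular_module R) T = Idl T"
    by (auto simp: gen_submodule_def genideal_def submodule_regular_iff[OF cring])
  ultimately show "\<exists>T. finite T \<and> T \<subseteq> H \<and> gen_submodule R (regular_module R) T = H"
    using T by blast
qed

text \<open>The coordinates on \<open>S\<close> are maps into the Noetherian module \<open>R\<close>
  that vanish together only on zero, so the decomposition leaves no remainder.\<close>

lemma free_module_noetherian:
  assumes "finite S"
  shows "noetherian_module R (free_module R S)"
  unfolding noetherian_module_def
proof (intro conjI allI impI free_module_module)
  fix H assume H: "submodule H R (free_module R S)"
  interpret F: Module.module R "free_module R S" by (rule free_module_module)
  have "(\<lambda>v. v b) \<in> mod_hom R (free_module R S) (regular_module R)" for b
    by (rule mod_homI) (auto simp: free_module_carrier_iff)
  then obtain T where T: "finite T" "T \<subseteq> H"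
    "\<forall>z\<in>H. \<exists>t\<in>gen_submodule R (free_module R S) T. \<exists>k\<in>H. (\<forall>b\<in>S. k b = \<zero>) \<and> z = t \<oplus>\<^bsub>free_module R S\<^esub> k"
    using noetherian_decomposition[OF free_module_module regular_module_noetherian assms, of "\<lambda>b v. v b" S H] H
    by auto
  have "H \<subseteq> gen_submodule R (free_module R S) T"
  proof
    fix z assume "z \<in> H"
    then obtain t k where tk: "t \<in> gen_submodule R (free_module R S) T" "k \<in> H"
        "\<forall>b\<in>S. k b = \<zero>" "z = t \<oplus>\<^bsub>free_module R S\<^esub> k"
      using T(3) by blast
    have Tc: "T \<subseteq> carrier (free_module R S)"
      using T(2) F.submoduleE(1)[OF H] by blast
    have "t \<in> carrier (free_module R S)"
      using tk F.submoduleE(1)[OF F.submodule_gen[OF Tc]] by blast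
    moreover have "k \<in> carrier (free_module R S)"
      using tk F.submoduleE(1)[OF H] by blast
    ultimately have "z = t"
      using tk(3,4) by (fastforce simp: free_module_carrier_iff)
    then show "z \<in> gen_submodule R (free_module R S) T" using tk by simp
  qed
  then show "\<exists>T. finite T \<and> T \<subseteq> H \<and> gen_submodule R (free_module R S) T = H"
    using T gen_submodule_least[OF H T(2)] by blast
qed

text \<open>A submodule of \<open>N\<close> is the image of its preimage in a free module of finite
  rank, and generators of the preimage map to generators.\<close>

lemma fg_module_noetherian:
  assumes "fg_module R N"
  shows "noetherian_module R N"
proof -
  have N: "Module.module R N" using assms by (simp add: fg_module_def)
  obtain S where S: "finite S" "S \<subseteq> carrier N" "gen_submodule R N S = carrier N"
    using assms by (auto simp: fg_module_def)
  let ?f = "free_ext R N (\<lambda>x. x)"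
  have hom: "?f \<in> mod_hom R (free_module R S) N"
    using S(2) by (intro free_ext_hom N) auto
  have surj: "?f ` carrier (free_module R S) = carrier N"
    using free_ext_image[OF N, of S "\<lambda>x. x"] S by auto
  interpret F: Module.module R "free_module R S" by (rule free_module_module)
  show ?thesis
    unfolding noetherian_module_def
  proof (intro conjI allI impI N)
    fix H assume H: "submodule H R N"
    let ?K = "{x \<in> carrier (free_module R S). ?f x \<in> H}"
    have K: "submodule ?K R (free_module R S)"
      by (rule submodule_vimage[OF free_module_module N hom H F.carrier_is_submodule])
    obtain T where T: "finite T" "T \<subseteq> ?K" "gen_submodule R (free_module R S) T = ?K"
      using noetherian_moduleE[OF free_module_noetherian[OF S(1)] K] .
    have "H \<subseteq> carrier N" using Module.module.submoduleE(1)[OF N H] .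
    then have "?f ` ?K = H" using surj by auto
    moreover have "T \<subseteq> carrier (free_module R S)" using T(2) by auto
    ultimately have "gen_submodule R N (?f ` T) = H"
      using gen_submodule_image[OF free_module_module N hom, of T] T(3) by simp
    then show "\<exists>T. finite T \<and> T \<subseteq> H \<and> gen_submodule R N T = H"
      using T(1,2) by (intro exI[of _ "?f ` T"]) auto
  qed
qed

end

section \<open>Modules of homomorphisms and quotient modules\<close>

lemma hom_module_simps [simp]:
  "carrier (hom_module R A B) = mod_hom R A B \<inter> extensional (carrier A)"
  "\<zero>\<^bsub>hom_module R A B\<^esub> = (\<lambda>x \<in> carrier A. \<zero>\<^bsub>B\<^esub>)"
  "f \<oplus>\<^bsub>hom_module R A B\<^esub> g = (\<lambda>x \<in> carrier A. f x \<oplus>\<^bsub>B\<^esub> g x)"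
  "r \<odot>\<^bsub>hom_module R A B\<^esub> f = (\<lambda>x \<in> carrier A. r \<odot>\<^bsub>B\<^esub> f x)"
  by (auto simp: hom_module_def)

text \<open>\<open>hom_module\<close> admits only maps that are \<open>undefined\<close> off the
  carrier, so that maps agreeing on \<open>A\<close> are equal. A linear map has to be cut down like
  this before it counts as a cochain.\<close>

lemma restrict_mod_hom:
  assumes "Module.module R A" "f \<in> mod_hom R A B"
  shows "restrict f (carrier A) \<in> mod_hom R A B"
proof -
  interpret A: Module.module R A by fact
  show ?thesis
    by (rule mod_homI)
      (auto simp: mod_hom_closed[OF assms(2)] mod_hom_add[OF assms(2)] mod_hom_smult[OF assms(2)])
qed

lemma hom_module_module:
  assumes A: "Module.module R A" and B: "Module.module R B"
  shows "Module.module R (hom_module R A B)"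
proof -
  interpret A: Module.module R A by fact
  interpret B: Module.module R B by fact
  have add: "(\<lambda>x \<in> carrier A. f x \<oplus>\<^bsub>B\<^esub> g x) \<in> mod_hom R A B"
    if f: "f \<in> mod_hom R A B" and g: "g \<in> mod_hom R A B" for f g
    by (rule mod_homI)
      (auto simp: mod_hom_closed[OF f] mod_hom_add[OF f] mod_hom_smult[OF f] mod_hom_closed[OF g]
        mod_hom_add[OF g] mod_hom_smult[OF g] B.M.a_ac B.smult_r_distr)
  have smult: "(\<lambda>x \<in> carrier A. r \<odot>\<^bsub>B\<^esub> f x) \<in> mod_hom R A B"
    if f: "f \<in> mod_hom R A B" and r: "r \<in> carrier R" for f r
    by (rule mod_homI)
      (auto simp: mod_hom_closed[OF f] mod_hom_add[OF f] mod_hom_smult[OF f] r B.smult_r_distr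
        B.smult_assoc1[symmetric] A.R.m_comm)
  have zero: "(\<lambda>x \<in> carrier A. \<zero>\<^bsub>B\<^esub>) \<in> mod_hom R A B"
    by (rule mod_homI) auto
  show ?thesis
  proof (intro moduleI abelian_groupI)
    fix f assume f: "f \<in> carrier (hom_module R A B)"
    then have fc: "f \<in> mod_hom R A B" by simp
    show "\<exists>g\<in>carrier (hom_module R A B). g \<oplus>\<^bsub>hom_module R A B\<^esub> f = \<zero>\<^bsub>hom_module R A B\<^esub>"
    proof
      show "(\<lambda>x \<in> carrier A. (\<ominus>\<^bsub>R\<^esub> \<one>\<^bsub>R\<^esub>) \<odot>\<^bsub>B\<^esub> f x) \<in> carrier (hom_module R A B)"
        using smult[OF fc] by simp
      show "(\<lambda>x \<in> carrier A. (\<ominus>\<^bsub>R\<^esub> \<one>\<^bsub>R\<^esub>) \<odot>\<^bsub>B\<^esub> f x) \<oplus>\<^bsub>hom_module R A B\<^esub> f = \<zero>\<^bsub>hom_module R A B\<^esub>"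
        by (auto simp: mod_hom_closed[OF fc] B.smult_l_minus B.M.l_neg intro!: restrict_ext)
    qed
  next
    fix f assume "f \<in> carrier (hom_module R A B)"
    then have f: "f \<in> mod_hom R A B" "f \<in> extensional (carrier A)" by auto
    show "\<zero>\<^bsub>hom_module R A B\<^esub> \<oplus>\<^bsub>hom_module R A B\<^esub> f = f"
      using f(2) by (auto simp: mod_hom_closed[OF f(1)] intro!: extensionalityI[OF restrict_extensional])
    show "\<one>\<^bsub>R\<^esub> \<odot>\<^bsub>hom_module R A B\<^esub> f = f"
      using f(2) by (auto simp: mod_hom_closed[OF f(1)] intro!: extensionalityI[OF restrict_extensional])
  qed (auto simp: add smult zero A.R.cring_axioms mod_hom_closed B.M.a_ac B.smult_l_distr B.smult_r_distr
        B.smult_assoc1 intro!: restrict_ext)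
qed

lemma mod_hom_restrict_carrier:
  assumes "f \<in> mod_hom R A B" "Z \<subseteq> carrier A" "\<And>x. x \<in> Z \<Longrightarrow> f x \<in> Y"
  shows "f \<in> mod_hom R (A\<lparr>carrier := Z\<rparr>) (B\<lparr>carrier := Y\<rparr>)"
  using assms(2,3)
  by (intro mod_homI) (auto simp: mod_hom_add[OF assms(1)] mod_hom_smult[OF assms(1)] subset_iff)

lemma quotient_module_simps [simp]:
  "carrier (quotient_module M H) = (\<lambda>x. H +>\<^bsub>M\<^esub> x) ` carrier M"
  "\<zero>\<^bsub>quotient_module M H\<^esub> = H"
  "X \<oplus>\<^bsub>quotient_module M H\<^esub> Y = X <+>\<^bsub>M\<^esub> Y"
  "r \<odot>\<^bsub>quotient_module M H\<^esub> X = (\<Union>x \<in> X. H +>\<^bsub>M\<^esub> (r \<odot>\<^bsub>M\<^esub> x))"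
  by (auto simp: quotient_module_def A_RCOSETS_def')

lemma (in Module.module) submodule_abelian_subgroup:
  "submodule H R M \<Longrightarrow> abelian_subgroup H M"
  by (intro abelian_subgroupI3 additive_subgroupI) (auto simp: submodule_def M.abelian_group_axioms)

text \<open>Induced maps on quotients are encoded as unions over all representatives. By
  \<open>HK\<close> all members of the union are the same coset, and there is at least one, because
  \<open>x\<close> lies in its own coset.\<close>

lemma (in Module.module) quotient_map_coset:
  assumes H: "submodule H R M" and B: "Module.module R B" and K: "submodule K R B"
    and \<phi>: "\<phi> \<in> mod_hom R M B" and HK: "\<And>h. h \<in> H \<Longrightarrow> \<phi> h \<in> K"
    and x: "x \<in> carrier M"
  shows "(\<Union>y \<in> H +>\<^bsub>M\<^esub> x. K +>\<^bsub>B\<^esub> \<phi> y) = K +>\<^bsub>B\<^esub> \<phi> x"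
proof -
  interpret B: Module.module R B by fact
  interpret H: abelian_subgroup H M by (rule submodule_abelian_subgroup[OF H])
  interpret K: abelian_subgroup K B by (rule B.submodule_abelian_subgroup[OF K])
  have "K +>\<^bsub>B\<^esub> \<phi> y = K +>\<^bsub>B\<^esub> \<phi> x" if y: "y \<in> H +>\<^bsub>M\<^esub> x" for y
  proof -
    obtain h where h: "h \<in> H" "y = h \<oplus>\<^bsub>M\<^esub> x" using y by (auto simp: a_r_coset_def')
    then have "\<phi> y = \<phi> h \<oplus>\<^bsub>B\<^esub> \<phi> x" using x mod_hom_add[OF \<phi>] by simp
    then have "\<phi> y \<in> K +>\<^bsub>B\<^esub> \<phi> x" using HK[OF h(1)] by (auto simp: a_r_coset_def')
    then show ?thesis
      using K.a_repr_independence' mod_hom_closed[OF \<phi> x] by blast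
  qed
  moreover have "x \<in> H +>\<^bsub>M\<^esub> x" using x by (rule H.a_rcos_self)
  ultimately show ?thesis by blast
qed

lemma (in Module.module) coset_hom:
  assumes H: "submodule H R M"
  shows "(\<lambda>x. H +>\<^bsub>M\<^esub> x) \<in> mod_hom R M (quotient_module M H)"
proof (rule mod_homI)
  interpret H: abelian_subgroup H M by (rule submodule_abelian_subgroup[OF H])
  fix x assume x: "x \<in> carrier M"
  show "H +>\<^bsub>M\<^esub> x \<in> carrier (quotient_module M H)" using x by simp
  { fix y assume "y \<in> carrier M"
    with x show "H +>\<^bsub>M\<^esub> (x \<oplus>\<^bsub>M\<^esub> y) = (H +>\<^bsub>M\<^esub> x) \<oplus>\<^bsub>quotient_module M H\<^esub> (H +>\<^bsub>M\<^esub> y)"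
      by (simp add: H.a_rcos_sum) }
  { fix r assume r: "r \<in> carrier R"
    \<comment> \<open>The scalar action on the quotient is the map induced by multiplication by
      \<open>r\<close>, which is linear because \<open>R\<close> is commutative.\<close>
    have "(\<lambda>x. r \<odot>\<^bsub>M\<^esub> x) \<in> mod_hom R M M"
      using r by (intro mod_homI) (auto simp: smult_r_distr smult_assoc1[symmetric] m_comm)
    then show "H +>\<^bsub>M\<^esub> (r \<odot>\<^bsub>M\<^esub> x) = r \<odot>\<^bsub>quotient_module M H\<^esub> (H +>\<^bsub>M\<^esub> x)"
      using quotient_map_coset[OF H module_axioms H _ _ x, of "\<lambda>x. r \<odot>\<^bsub>M\<^esub> x"] r submoduleE(4)[OF H]
      by simp }
qed

lemma (in Module.module) coset_zero:
  assumes H: "submodule H R M" and "h \<in> H"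
  shows "H +>\<^bsub>M\<^esub> h = H"
  using assms(2) abelian_subgroup.a_rcos_const[OF submodule_abelian_subgroup[OF H]] by simp

lemma (in Module.module) quotient_module_module:
  assumes H: "submodule H R M"
  shows "Module.module R (quotient_module M H)"
  by (rule module_surj_image[OF module_axioms coset_hom[OF H]])
    (auto simp: coset_zero[OF H] submodule_zero_closed[OF H])

lemma (in Module.module) quotient_map_hom:
  assumes H: "submodule H R M" and B: "Module.module R B" and K: "submodule K R B"
    and \<phi>: "\<phi> \<in> mod_hom R M B" and HK: "\<And>h. h \<in> H \<Longrightarrow> \<phi> h \<in> K"
  shows "(\<lambda>X. \<Union>y \<in> X. K +>\<^bsub>B\<^esub> \<phi> y) \<in> mod_hom R (quotient_module M H) (quotient_module B K)"
    (is "?f \<in> _")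
proof (rule mod_homI)
  interpret B: Module.module R B by fact
  have co: "?f (H +>\<^bsub>M\<^esub> x) = K +>\<^bsub>B\<^esub> \<phi> x" if "x \<in> carrier M" for x
    by (rule quotient_map_coset[OF H B K \<phi> HK that])
  note hM = mod_hom_add[OF coset_hom[OF H], symmetric] mod_hom_smult[OF coset_hom[OF H], symmetric]
  note hB = mod_hom_add[OF B.coset_hom[OF K]] mod_hom_smult[OF B.coset_hom[OF K]]
  fix X assume "X \<in> carrier (quotient_module M H)"
  then obtain x where x: "x \<in> carrier M" "X = H +>\<^bsub>M\<^esub> x" by auto
  show "?f X \<in> carrier (quotient_module B K)"
    unfolding x(2) co[OF x(1)] using mod_hom_closed[OF \<phi> x(1)] by simp
  { fix Y assume "Y \<in> carrier (quotient_module M H)"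
    then obtain y where y: "y \<in> carrier M" "Y = H +>\<^bsub>M\<^esub> y" by auto
    show "?f (X \<oplus>\<^bsub>quotient_module M H\<^esub> Y) = ?f X \<oplus>\<^bsub>quotient_module B K\<^esub> ?f Y"
      unfolding x(2) y(2) hM(1)[OF x(1) y(1)] co[OF x(1)] co[OF y(1)] co[OF M.a_closed[OF x(1) y(1)]]
        mod_hom_add[OF \<phi> x(1) y(1)] hB(1)[OF mod_hom_closed[OF \<phi> x(1)] mod_hom_closed[OF \<phi> y(1)]] .. }
  { fix r assume r: "r \<in> carrier R"
    show "?f (r \<odot>\<^bsub>quotient_module M H\<^esub> X) = r \<odot>\<^bsub>quotient_module B K\<^esub> ?f X"
      unfolding x(2) hM(2)[OF r x(1)] co[OF x(1)] co[OF smult_closed[OF r x(1)]]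
        mod_hom_smult[OF \<phi> r x(1)] hB(2)[OF r mod_hom_closed[OF \<phi> x(1)]] .. }
qed

text \<open>Cohomology takes cosets in the module of cocycles, whereas \<open>Ext_map\<close> takes
  them in the full cochain module. Both agree, since a coset depends on the addition only.\<close>

lemma a_r_coset_carrier_update: "H +>\<^bsub>M\<lparr>carrier := Y\<rparr>\<^esub> x = H +>\<^bsub>M\<^esub> x"
  by (simp add: a_r_coset_def')

section \<open>Cohomology\<close>

locale cochain_complex =
  fixes R :: "('a, 'r) ring_scheme" and C :: "nat \<Rightarrow> ('a, 'm, 'x) module_scheme" and d
  assumes module_C: "\<And>i. Module.module R (C i)"
    and hom_d: "\<And>i. d i \<in> mod_hom R (C i) (C (Suc i))"
    and d_d: "\<And>i x. x \<in> carrier (C i) \<Longrightarrow> d (Suc i) (d i x) = \<zero>\<^bsub>C (Suc (Suc i))\<^esub>"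
begin

lemma submodule_cocycles: "submodule (cocycles C d i) R (C i)"
proof -
  interpret A: Module.module R "C i" by (rule module_C)
  interpret B: Module.module R "C (Suc i)" by (rule module_C)
  have "submodule {\<zero>\<^bsub>C (Suc i)\<^esub>} R (C (Suc i))" by (rule B.submoduleI') auto
  from submodule_vimage[OF module_C module_C hom_d this A.carrier_is_submodule]
  show ?thesis by (simp add: cocycles_def)
qed

abbreviation cocycle_module where "cocycle_module i \<equiv> (C i)\<lparr>carrier := cocycles C d i\<rparr>"

lemma module_cocycles: "Module.module R (cocycle_module i)"
  by (rule restrict_module[OF module_C submodule_cocycles])

lemma submodule_coboundaries: "submodule (coboundaries C d i) R (cocycle_module i)"
proof -
  interpret A: Module.module R "C i" by (rule module_C)
  interpret Z: Module.module R "cocycle_module i" by (rule module_cocycles)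
  have sub: "submodule (coboundaries C d i) R (C i)"
  proof (cases i)
    case 0
    have "submodule {\<zero>\<^bsub>C i\<^esub>} R (C i)" by (rule A.submoduleI') auto
    then show ?thesis using 0 by (simp add: coboundaries_def)
  next
    case (Suc j)
    then show ?thesis
      unfolding coboundaries_def
      using submodule_image[OF module_C module_C hom_d Module.module.carrier_is_submodule[OF module_C[of j]]]
      by simp
  qed
  have "coboundaries C d i \<subseteq> cocycles C d i"
    using submodule_zero_closed[OF submodule_cocycles[of 0]] mod_hom_closed[OF hom_d]
    by (cases i) (auto simp: coboundaries_def cocycles_def d_d)
  then show ?thesis
    using A.submoduleE(4,5)[OF sub] submodule_zero_closed[OF sub]
    by (intro Z.submoduleI') auto
qed

lemma module_cohomology: "Module.module R (cohomology C d i)"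
  unfolding cohomology_def
  by (rule module.quotient_module_module[OF module_cocycles submodule_coboundaries])

text \<open>The summand \<open>k\<close> dies in the quotient, so the classes of \<open>T\<close>
  generate. The cocycles as a whole may well fail to be finitely generated; \<open>T\<close> has to
  span them only modulo coboundaries.\<close>

lemma cohomology_fg:
  assumes T: "finite T" "T \<subseteq> cocycles C d i"
    and dec: "\<And>z. z \<in> cocycles C d i \<Longrightarrow>
      \<exists>t\<in>gen_submodule R (cocycle_module i) T. \<exists>k\<in>coboundaries C d i. z = t \<oplus>\<^bsub>C i\<^esub> k"
  shows "fg_module R (cohomology C d i)"
proof -
  interpret Z: Module.module R "cocycle_module i" by (rule module_cocycles)
  let ?B = "coboundaries C d i" and ?Q = "cohomology C d i"
  note B = submodule_coboundaries[of i]
  let ?p = "\<lambda>x. ?B +>\<^bsub>cocycle_module i\<^esub> x"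
  have Q: "Module.module R ?Q" by (rule module_cohomology)
  interpret Q: Module.module R ?Q by (rule Q)
  have p: "?p \<in> mod_hom R (cocycle_module i) ?Q"
    unfolding cohomology_def by (rule Z.coset_hom[OF B])
  have Tc: "T \<subseteq> carrier (cocycle_module i)" using T by simp
  have pT: "?p ` T \<subseteq> carrier ?Q" using Tc mod_hom_closed[OF p] by blast
  have "carrier ?Q \<subseteq> gen_submodule R ?Q (?p ` T)"
  proof
    fix X assume "X \<in> carrier ?Q"
    then obtain z where z: "z \<in> cocycles C d i" "X = ?p z" by (auto simp: cohomology_def)
    obtain t k where tk: "t \<in> gen_submodule R (cocycle_module i) T" "k \<in> ?B" "z = t \<oplus>\<^bsub>C i\<^esub> k"
      using dec[OF z(1)] by blast
    have t: "t \<in> carrier (cocycle_module i)"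
      using tk(1) Z.submoduleE(1)[OF Z.submodule_gen[OF Tc]] by blast
    have k: "k \<in> carrier (cocycle_module i)"
      using tk(2) Z.submoduleE(1)[OF B] by blast
    have "?p k = \<zero>\<^bsub>?Q\<^esub>"
      using Z.coset_zero[OF B tk(2)] by (simp add: cohomology_def)
    then have "X = ?p t"
      using mod_hom_add[OF p t k] z(2) tk(3) mod_hom_closed[OF p t] by simp
    then show "X \<in> gen_submodule R ?Q (?p ` T)"
      using tk(1) gen_submodule_image[OF Z.module_axioms Q p Tc] by blast
  qed
  then have "gen_submodule R ?Q (?p ` T) = carrier ?Q"
    using Q.submoduleE(1)[OF Q.submodule_gen[OF pT]] by blast
  then show ?thesis
    using T(1) pT Q unfolding fg_module_def by blast
qed

text \<open>A chain map preserves cocycles and coboundaries. The induced map is written as the union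
  that occurs in \<open>Ext_map\<close>, so that it applies there by unfolding.\<close>

lemma cohomology_map:
  assumes C': "cochain_complex R C' d'"
    and \<phi>: "\<And>i. \<phi> i \<in> mod_hom R (C i) (C' i)"
    and comm: "\<And>i x. x \<in> carrier (C i) \<Longrightarrow> \<phi> (Suc i) (d i x) = d' i (\<phi> i x)"
  shows "(\<lambda>X. \<Union>y \<in> X. coboundaries C' d' i +>\<^bsub>C' i\<^esub> \<phi> i y) \<in> mod_hom R (cohomology C d i) (cohomology C' d' i)"
    and "z \<in> cocycles C d i \<Longrightarrow>
      (\<Union>y \<in> coboundaries C d i +>\<^bsub>C i\<^esub> z. coboundaries C' d' i +>\<^bsub>C' i\<^esub> \<phi> i y) = coboundaries C' d' i +>\<^bsub>C' i\<^esub> \<phi> i z"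
proof -
  interpret C': cochain_complex R C' d' by fact
  interpret Z: Module.module R "cocycle_module i" by (rule module_cocycles)
  have \<phi>0: "\<phi> j \<zero>\<^bsub>C j\<^esub> = \<zero>\<^bsub>C' j\<^esub>" for j
    by (rule mod_hom_zero[OF module_C C'.module_C \<phi>])
  have 1: "\<phi> i \<in> mod_hom R (cocycle_module i) (C'.cocycle_module i)"
  proof (rule mod_hom_restrict_carrier[OF \<phi>])
    fix x assume "x \<in> cocycles C d i"
    then show "\<phi> i x \<in> cocycles C' d' i"
      using mod_hom_closed[OF \<phi>, of x i] comm[of x i, symmetric] \<phi>0[of "Suc i"] by (auto simp: cocycles_def)
  qed (auto simp: cocycles_def)
  have 2: "\<phi> i h \<in> coboundaries C' d' i" if "h \<in> coboundaries C d i" for h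
    using that mod_hom_closed[OF \<phi>] by (cases i) (auto simp: coboundaries_def \<phi>0 comm)
  show "(\<lambda>X. \<Union>y \<in> X. coboundaries C' d' i +>\<^bsub>C' i\<^esub> \<phi> i y) \<in> mod_hom R (cohomology C d i) (cohomology C' d' i)"
    using Z.quotient_map_hom[OF submodule_coboundaries C'.module_cocycles C'.submodule_coboundaries 1 2]
    by (simp add: cohomology_def a_r_coset_carrier_update)
  show "(\<Union>y \<in> coboundaries C d i +>\<^bsub>C i\<^esub> z. coboundaries C' d' i +>\<^bsub>C' i\<^esub> \<phi> i y) = coboundaries C' d' i +>\<^bsub>C' i\<^esub> \<phi> i z"
    if "z \<in> cocycles C d i"
    using Z.quotient_map_coset[OF submodule_coboundaries C'.module_cocycles C'.submodule_coboundaries 1 2, of z] that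
    by (simp add: a_r_coset_carrier_update)
qed

end

section \<open>The functorial free resolution\<close>

definition cell_bd :: "('a, 'r) ring_scheme \<Rightarrow> ('a, 'm) cell \<Rightarrow> ('a, 'm) cell \<Rightarrow> 'a"
  where "cell_bd R c = (case c of Gen m \<Rightarrow> (\<lambda>_. \<zero>\<^bsub>R\<^esub>) | Rel l \<Rightarrow> lincomb R l)"

definition cell_aug :: "('a, 'm, 'x) module_scheme \<Rightarrow> ('a, 'm) cell \<Rightarrow> 'm"
  where "cell_aug M c = (case c of Gen m \<Rightarrow> m | Rel l \<Rightarrow> \<zero>\<^bsub>M\<^esub>)"

definition cell_map :: "('m \<Rightarrow> 'k) \<Rightarrow> ('a, 'm) cell \<Rightarrow> ('a, 'k) cell"
  where "cell_map h = map_cell id h"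

lemma cell_map_simps [simp]:
  "cell_map h (Gen m) = Gen (h m)"
  "cell_map h (Rel l) = Rel (map (map_prod id (cell_map h)) l)"
  by (simp_all add: cell_map_def)

lemma cell_bd_Rel [simp]: "cell_bd R (Rel l) = lincomb R l"
  and cell_aug_Gen [simp]: "cell_aug M (Gen m) = m"
  by (simp_all add: cell_bd_def cell_aug_def)

text \<open>The kernel of the map that leaves degree \<open>i\<close>: the augmentation if
  \<open>i = 0\<close>, the differential otherwise. With it the basis in degree \<open>Suc i\<close>
  has one description for all \<open>i\<close>, see \<open>Rel_basis_iff\<close>.\<close>

definition res_ker ::
  "('a, 'r) ring_scheme \<Rightarrow> ('a, 'm, 'x) module_scheme \<Rightarrow> nat \<Rightarrow> (('a, 'm) cell \<Rightarrow> 'a) set"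
  where
  "res_ker R M i = {v \<in> carrier (res_module R M i).
     if i = 0 then res_aug R M v = \<zero>\<^bsub>M\<^esub> else res_diff R v = (\<lambda>_. \<zero>\<^bsub>R\<^esub>)}"

lemma lincomb_Nil [simp]: "lincomb R [] = (\<lambda>_. \<zero>\<^bsub>R\<^esub>)"
  and lincomb_Cons: "lincomb R ((r, c) # l) = (\<lambda>b. (if c = b then r else \<zero>\<^bsub>R\<^esub>) \<oplus>\<^bsub>R\<^esub> lincomb R l b)"
  by (auto simp: lincomb_def)

lemma res_aug_eq: "res_aug R M = free_ext R M (cell_aug M)"
  by (simp add: fun_eq_iff res_aug_def free_ext_def cell_aug_def)

context cring
begin

lemma lincomb_Cons_delta:
  "r \<in> carrier R \<Longrightarrow> lincomb R ((r, c) # l) = (\<lambda>b. r \<otimes> delta R c b \<oplus> lincomb R l b)"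
  by (auto simp: lincomb_Cons delta_def fun_eq_iff)

lemma lincomb_closed:
  "l \<in> lists (carrier R \<times> B) \<Longrightarrow> lincomb R l \<in> carrier (free_module R B)"
proof (induction l)
  case Nil
  then show ?case by (simp add: free_module_carrier_iff)
next
  case (Cons p l)
  then show ?case
    by (cases p) (auto simp: lincomb_Cons_delta intro!: free_module_add_closed
        free_module_smult_closed delta_closed)
qed

lemma lincomb_surj:
  assumes "v \<in> carrier (free_module R B)"
  shows "\<exists>l \<in> lists (carrier R \<times> B). v = lincomb R l"
  using assms
proof (induction rule: free_module_induct)
  case zero
  show ?case by (intro bexI[of _ "[]"]) auto
next
  case (add v r c)
  then obtain l where "l \<in> lists (carrier R \<times> B)" "v = lincomb R l" by auto
  then show ?case
    using add by (intro bexI[of _ "(r, c) # l"]) (auto simp: lincomb_Cons_delta)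
qed

text \<open>The target basis \<open>B'\<close> is left open because the lemma is used both with the
  whole basis of \<open>F i\<close> and with a finite set of cells that supports all boundaries in
  question.\<close>

lemma res_diff_eq:
  fixes v :: "('a, 'm) cell \<Rightarrow> 'a"
  assumes v: "v \<in> carrier (free_module R B)"
    and bd: "\<And>c. c \<in> B \<Longrightarrow> cell_bd R c \<in> carrier (free_module R B')"
  shows "res_diff R v = free_ext R (free_module R B') (cell_bd R) v"
proof
  fix b :: "('a, 'm) cell"
  have eq: "(case c of Gen m \<Rightarrow> \<zero> | Rel l \<Rightarrow> lincomb R l b) = cell_bd R c b" for c
    by (cases c) (auto simp: cell_bd_def)
  have "free_ext R (free_module R B') (cell_bd R) v b
    = (\<Oplus>c \<in> {c. v c \<noteq> \<zero>}. (v c \<odot>\<^bsub>free_module R B'\<^esub> cell_bd R c) b)"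
    unfolding free_ext_def
    using v bd by (intro finsum_free_module)
      (auto simp: free_module_carrier_iff[of v] intro!: free_module_smult_closed)
  then show "res_diff R v b = free_ext R (free_module R B') (cell_bd R) v b"
    by (simp add: res_diff_def eq)
qed

text \<open>The coefficient at \<open>b\<close> collects those of all cells over \<open>b\<close>,
  as it must for the linear map sending basis vectors to basis vectors along
  \<open>cell_map h\<close>.\<close>

lemma res_map_eq:
  fixes v :: "('a, 'm) cell \<Rightarrow> 'a" and h :: "'m \<Rightarrow> 'k"
  assumes v: "v \<in> carrier (free_module R B)"
    and h: "\<And>c. c \<in> B \<Longrightarrow> cell_map h c \<in> B'"
  shows "res_map R h v = free_ext R (free_module R B') (\<lambda>c. delta R (cell_map h c)) v"
proof
  fix b :: "('a, 'k) cell"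
  have vs: "finite {c. v c \<noteq> \<zero>}" "\<And>c. v c \<in> carrier R" using v by (auto simp: free_module_carrier_iff)
  have "free_ext R (free_module R B') (\<lambda>c. delta R (cell_map h c)) v b
    = (\<Oplus>c \<in> {c. v c \<noteq> \<zero>}. (v c \<odot>\<^bsub>free_module R B'\<^esub> delta R (cell_map h c)) b)"
    unfolding free_ext_def
    using v h by (intro finsum_free_module)
      (auto simp: free_module_carrier_iff[of v] intro!: free_module_smult_closed delta_closed)
  also have "\<dots> = (\<Oplus>c \<in> {c. v c \<noteq> \<zero> \<and> cell_map h c = b}. v c)"
    using vs by (intro add.finprod_mono_neutral_cong_right) (auto simp: delta_def)
  finally show "res_map R h v b = free_ext R (free_module R B') (\<lambda>c. delta R (cell_map h c)) v b"
    by (simp only: res_map_def cell_map_def)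
qed

end

locale free_resolution = Module.module R M
  for R :: "('a, 'r) ring_scheme" (structure) and M :: "('a, 'm, 'x) module_scheme" (structure)
begin

abbreviation "F i \<equiv> res_module R M i"
abbreviation "bdry \<equiv> res_diff R :: (('a, 'm) cell \<Rightarrow> 'a) \<Rightarrow> ('a, 'm) cell \<Rightarrow> 'a"
abbreviation "K i \<equiv> res_ker R M i"

lemma F_def: "F i = free_module R (res_basis R M i)"
  by (simp add: res_module_def)

lemma module_F: "Module.module R (F i)"
  unfolding F_def by (rule free_module_module)

lemma aug_hom: "res_aug R M \<in> mod_hom R (F 0) M"
  unfolding res_aug_eq F_def by (rule free_ext_hom[OF module_axioms]) auto

lemma aug_delta: "m \<in> carrier M \<Longrightarrow> res_aug R M (delta R (Gen m)) = m"
  unfolding res_aug_eq by (subst free_ext_delta[OF module_axioms]) auto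

lemma Rel_basis_iff:
  "c \<in> res_basis R M (Suc i) \<longleftrightarrow>
    (\<exists>l. c = Rel l \<and> l \<in> lists (carrier R \<times> res_basis R M i) \<and> lincomb R l \<in> K i)"
  by (cases i) (auto simp: res_ker_def F_def image_iff intro!: lincomb_closed)

lemma bd_K: "c \<in> res_basis R M (Suc i) \<Longrightarrow> cell_bd R c \<in> K i"
  by (auto simp: Rel_basis_iff)

lemma K_subset: "K i \<subseteq> carrier (F i)"
  by (auto simp: res_ker_def)

lemma bd_closed: "c \<in> res_basis R M (Suc i) \<Longrightarrow> cell_bd R c \<in> carrier (F i)"
  using bd_K K_subset by blast

lemma diff_eq:
  assumes "S \<subseteq> res_basis R M (Suc i)" "v \<in> carrier (free_module R S)"
  shows "bdry v = free_ext R (F i) (cell_bd R) v"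
  unfolding F_def using assms bd_closed by (intro res_diff_eq[of v S]) (auto simp: F_def)

lemma diff_hom: "bdry \<in> mod_hom R (F (Suc i)) (F i)"
proof -
  have f: "free_ext R (F i) (cell_bd R) \<in> mod_hom R (F (Suc i)) (F i)"
    using bd_closed by (subst (2) F_def, intro free_ext_hom module_F) auto
  have "bdry v = free_ext R (F i) (cell_bd R) v" if "v \<in> carrier (F (Suc i))" for v
    using that by (intro diff_eq[OF subset_refl]) (simp add: F_def)
  then show ?thesis
    using f Module.module.smult_closed[OF module_F[of "Suc i"]] abelian_monoid.a_closed[of "F (Suc i)"]
      abelian_group.axioms(1)[OF Module.module.axioms(2)[OF module_F[of "Suc i"]]]
    by (auto simp: mod_hom_def)
qed

lemma diff_delta:
  assumes "c \<in> res_basis R M (Suc i)"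
  shows "bdry (delta R c) = cell_bd R c"
proof -
  have "bdry (delta R c) = free_ext R (F i) (cell_bd R) (delta R c)"
    using assms by (intro diff_eq[OF subset_refl] delta_closed)
  also have "\<dots> = cell_bd R c"
    by (rule free_ext_delta[of "F i" "cell_bd R", OF module_F bd_closed[OF assms]])
  finally show ?thesis .
qed

lemma submodule_K: "submodule (K i) R (F i)"
proof (cases i)
  case 0
  have "submodule {\<zero>\<^bsub>M\<^esub>} R M" by (rule submoduleI') auto
  from submodule_vimage[OF module_F module_axioms aug_hom this Module.module.carrier_is_submodule[OF module_F]]
  show ?thesis by (simp add: res_ker_def 0)
next
  case (Suc j)
  interpret Fj: Module.module R "F j" by (rule module_F)
  have "submodule {\<zero>\<^bsub>F j\<^esub>} R (F j)" by (rule Fj.submoduleI') auto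
  from submodule_vimage[OF module_F module_F diff_hom this Module.module.carrier_is_submodule[OF module_F]]
  show ?thesis by (simp add: res_ker_def Suc F_def)
qed

lemma diff_in_K:
  assumes "v \<in> carrier (F (Suc i))"
  shows "bdry v \<in> K i"
  by (rule free_module_hom_in_submodule[OF module_F diff_hom[of i, unfolded F_def[of "Suc i"]]
        submodule_K _ assms[unfolded F_def]])
    (simp add: diff_delta bd_K)

lemma diff_diff: "v \<in> carrier (F (Suc (Suc i))) \<Longrightarrow> bdry (bdry v) = \<zero>\<^bsub>F i\<^esub>"
  using diff_in_K[of v "Suc i"] by (simp add: res_ker_def F_def)

lemma K_image:
  assumes "v \<in> K i"
  shows "\<exists>l \<in> lists (carrier R \<times> res_basis R M i). v = lincomb R l \<and> Rel l \<in> res_basis R M (Suc i)"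
proof -
  have "v \<in> carrier (free_module R (res_basis R M i))"
    using assms K_subset by (auto simp: F_def)
  from lincomb_surj[OF this] assms show ?thesis
    by (auto simp: Rel_basis_iff)
qed

text \<open>A single basis vector suffices as preimage: write \<open>v\<close> as the combination of
  a list \<open>l\<close> and take the cell \<open>Rel l\<close>.\<close>

lemma K_exact:
  assumes "v \<in> K i"
  shows "\<exists>u \<in> carrier (F (Suc i)). bdry u = v"
proof -
  obtain l where l: "v = lincomb R l" "Rel l \<in> res_basis R M (Suc i)"
    using K_image[OF assms] by blast
  then show ?thesis
    by (intro bexI[of _ "delta R (Rel l)"]) (auto simp: diff_delta F_def delta_closed)
qed

end

section \<open>Functoriality of the resolution in the module\<close>

locale resolution_map = M: free_resolution R M + M': free_resolution R M'
  for R :: "('a, 'r) ring_scheme" (structure) and M :: "('a, 'm, 'x) module_scheme"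
    and M' :: "('a, 'k, 'y) module_scheme" +
  fixes h
  assumes hom_h: "h \<in> mod_hom R M M'"
begin

context
  fixes i
  assumes basis: "\<And>c. c \<in> res_basis R M i \<Longrightarrow> cell_map h c \<in> res_basis R M' i"
begin

text \<open>That \<open>cell_map h\<close> respects the bases is proved degree by degree, and the
  proof relies on properties of \<open>res_map\<close> in lower degrees. Hence it is an assumption
  for one fixed \<open>i\<close> here, to be supplied by the induction in
  \<open>res_map_basis_ker\<close>.\<close>

lemma res_map_eq_ext:
  "v \<in> carrier (M.F i) \<Longrightarrow> res_map R h v = free_ext R (M'.F i) (\<lambda>c. delta R (cell_map h c)) v"
  unfolding M'.F_def M.F_def by (rule M.res_map_eq[OF _ basis])

lemma res_map_hom_aux: "res_map R h \<in> mod_hom R (M.F i) (M'.F i)"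
proof -
  interpret F: Module.module R "M.F i" by (rule M.module_F)
  have f: "free_ext R (M'.F i) (\<lambda>c. delta R (cell_map h c)) \<in> mod_hom R (M.F i) (M'.F i)"
    unfolding M.F_def M'.F_def by (intro M.free_ext_hom M.free_module_module M.delta_closed basis)
  show ?thesis
    by (rule mod_homI)
      (simp_all add: res_map_eq_ext mod_hom_closed[OF f] mod_hom_add[OF f] mod_hom_smult[OF f])
qed

lemma res_map_delta_aux: "c \<in> res_basis R M i \<Longrightarrow> res_map R h (delta R c) = delta R (cell_map h c)"
  by (subst res_map_eq_ext)
    (auto simp: M.F_def M'.F_def basis intro!: M.delta_closed M.free_ext_delta[of _ "\<lambda>c. delta R (cell_map h c)"] M.free_module_module)

text \<open>The boundary of the image of a cell is the image of its boundary. This holds even if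
  \<open>h\<close> identifies cells: their entries stay separate in the list, and
  \<open>lincomb\<close> adds the coefficients just as \<open>res_map\<close> does.\<close>

lemma res_map_lincomb_aux:
  "l \<in> lists (carrier R \<times> res_basis R M i) \<Longrightarrow>
    res_map R h (lincomb R l) = lincomb R (map (map_prod id (cell_map h)) l)"
proof (induction l)
  case Nil
  show ?case
    using mod_hom_zero[OF M.module_F M'.module_F res_map_hom_aux] by (simp add: M.F_def M'.F_def)
next
  case (Cons p l)
  obtain r c where p: "p = (r, c)" "r \<in> carrier R" "c \<in> res_basis R M i"
    using Cons by auto
  have l: "lincomb R l \<in> carrier (M.F i)" and d: "delta R c \<in> carrier (M.F i)"
    using Cons p by (auto simp: M.F_def intro!: M.lincomb_closed M.delta_closed)
  have rd: "(\<lambda>b. r \<otimes> delta R c b) \<in> carrier (M.F i)"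
    using d p unfolding M.F_def by (intro M.free_module_smult_closed) auto
  have "res_map R h (lincomb R (p # l)) = (\<lambda>b. r \<otimes> delta R (cell_map h c) b \<oplus> res_map R h (lincomb R l) b)"
    using mod_hom_add[OF res_map_hom_aux rd l] mod_hom_smult[OF res_map_hom_aux p(2) d] p
    by (simp add: M.lincomb_Cons_delta M.F_def M'.F_def res_map_delta_aux)
  then show ?case
    using Cons p by (simp add: M.lincomb_Cons_delta)
qed

end

lemma bdry_res_map_aux:
  assumes basis: "\<And>c. c \<in> res_basis R M i \<Longrightarrow> cell_map h c \<in> res_basis R M' i"
    and basis': "\<And>c. c \<in> res_basis R M (Suc i) \<Longrightarrow> cell_map h c \<in> res_basis R M' (Suc i)"
    and v: "v \<in> carrier (M.F (Suc i))"
  shows "res_diff R (res_map R h v) = res_map R h (res_diff R v)"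
  using v unfolding M.F_def
proof (rule M.free_module_hom_eqI[OF M'.module_F, rotated -1])
  show "(\<lambda>v. res_diff R (res_map R h v)) \<in> mod_hom R (free_module R (res_basis R M (Suc i))) (M'.F i)"
    using mod_hom_comp[OF res_map_hom_aux[OF basis'] M'.diff_hom] by (simp add: M.F_def)
  show "(\<lambda>v. res_map R h (res_diff R v)) \<in> mod_hom R (free_module R (res_basis R M (Suc i))) (M'.F i)"
    using mod_hom_comp[OF M.diff_hom res_map_hom_aux[OF basis]] by (simp add: M.F_def)
  fix c assume c: "c \<in> res_basis R M (Suc i)"
  then obtain l where l: "c = Rel l" "l \<in> lists (carrier R \<times> res_basis R M i)"
    by (auto simp: M.Rel_basis_iff)
  show "res_diff R (res_map R h (delta R c)) = res_map R h (res_diff R (delta R c))"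
    using c basis'[OF c] res_map_lincomb_aux[OF basis l(2)]
    by (simp add: res_map_delta_aux[OF basis'] M'.diff_delta M.diff_delta) (simp add: l)
qed

text \<open>The two claims need each other. A cell in degree \<open>Suc i\<close> maps to a cell
  because its boundary in \<open>K i\<close> maps into the kernel; kernels in degree
  \<open>Suc i\<close> are preserved because \<open>res_map\<close> commutes with the differential,
  which presupposes the claim on bases in both degrees.\<close>

lemma res_map_basis_ker:
  "(\<forall>c \<in> res_basis R M i. cell_map h c \<in> res_basis R M' i) \<and> (\<forall>v \<in> M.K i. res_map R h v \<in> M'.K i)"
proof (induction i)
  case 0
  have basis: "cell_map h c \<in> res_basis R M' 0" if "c \<in> res_basis R M 0" for c
    using that mod_hom_closed[OF hom_h] by auto
  have "res_aug R M' (res_map R h v) = h (res_aug R M v)" if "v \<in> carrier (M.F 0)" for v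
    using that unfolding M.F_def
  proof (rule M.free_module_hom_eqI[OF M'.module_axioms, rotated -1])
    show "(\<lambda>v. res_aug R M' (res_map R h v)) \<in> mod_hom R (free_module R (res_basis R M 0)) M'"
      using mod_hom_comp[OF res_map_hom_aux[OF basis] M'.aug_hom] by (simp add: M.F_def)
    show "(\<lambda>v. h (res_aug R M v)) \<in> mod_hom R (free_module R (res_basis R M 0)) M'"
      using mod_hom_comp[OF M.aug_hom hom_h] by (simp add: M.F_def)
    fix c assume c: "c \<in> res_basis R M 0"
    then obtain m where m: "c = Gen m" "m \<in> carrier M" by auto
    show "res_aug R M' (res_map R h (delta R c)) = h (res_aug R M (delta R c))"
      using res_map_delta_aux[OF basis c] m mod_hom_closed[OF hom_h m(2)]
      by (simp add: M.aug_delta M'.aug_delta)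
  qed
  then show ?case
    using basis mod_hom_closed[OF res_map_hom_aux[OF basis]]
      mod_hom_zero[OF M.module_axioms M'.module_axioms hom_h]
    by (auto simp: res_ker_def)
next
  case (Suc i)
  have basis: "cell_map h c \<in> res_basis R M' i" if "c \<in> res_basis R M i" for c
    using Suc that by blast
  have basis': "cell_map h c \<in> res_basis R M' (Suc i)" if c: "c \<in> res_basis R M (Suc i)" for c
  proof -
    obtain l where l: "c = Rel l" "l \<in> lists (carrier R \<times> res_basis R M i)" "lincomb R l \<in> M.K i"
      using c by (auto simp: M.Rel_basis_iff)
    have "lincomb R (map (map_prod id (cell_map h)) l) \<in> M'.K i"
      using Suc l(3) res_map_lincomb_aux[OF basis l(2)] by auto
    moreover have "map (map_prod id (cell_map h)) l \<in> lists (carrier R \<times> res_basis R M' i)"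
      using l(2) basis by (auto simp: in_lists_conv_set)
    ultimately show ?thesis
      using l(1) by (simp add: M'.Rel_basis_iff)
  qed
  have "res_map R h v \<in> M'.K (Suc i)" if "v \<in> M.K (Suc i)" for v
  proof -
    have v: "v \<in> carrier (M.F (Suc i))" "res_diff R v = \<zero>\<^bsub>M.F i\<^esub>"
      using that by (auto simp: res_ker_def M.F_def)
    have "res_diff R (res_map R h v) = \<zero>\<^bsub>M'.F i\<^esub>"
      using bdry_res_map_aux[OF basis basis' v(1)] v(2)
        mod_hom_zero[OF M.module_F M'.module_F res_map_hom_aux[OF basis]] by simp
    then show ?thesis
      using mod_hom_closed[OF res_map_hom_aux[OF basis'] v(1)] by (simp add: res_ker_def M'.F_def)
  qed
  then show ?case using basis' by blast
qed

lemma map_basis: "c \<in> res_basis R M i \<Longrightarrow> cell_map h c \<in> res_basis R M' i"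
  using res_map_basis_ker by blast

lemma res_map_hom: "res_map R h \<in> mod_hom R (M.F i) (M'.F i)"
  by (rule res_map_hom_aux) (rule map_basis)

lemma bdry_res_map:
  "v \<in> carrier (M.F (Suc i)) \<Longrightarrow> res_diff R (res_map R h v) = res_map R h (res_diff R v)"
  by (rule bdry_res_map_aux) (erule map_basis | assumption)+

lemma res_map_delta: "c \<in> res_basis R M i \<Longrightarrow> res_map R h (delta R c) = delta R (cell_map h c)"
  by (rule res_map_delta_aux) (rule map_basis)

end

text \<open>Since \<open>h\<close> fixes only elements of \<open>M\<close>, the induction runs over
  the degree of basis cells: the entries of a list in degree \<open>Suc i\<close> are basis cells of
  degree \<open>i\<close>.\<close>

lemma cell_map_id_on_basis:
  assumes "\<And>x. x \<in> carrier M \<Longrightarrow> h x = x"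
  shows "c \<in> res_basis R M i \<Longrightarrow> cell_map h c = c"
proof (induction i arbitrary: c)
  case 0
  then show ?case using assms by auto
next
  case (Suc i)
  then obtain l where "c = Rel l" "l \<in> lists (carrier R \<times> res_basis R M i)"
    by (cases i) auto
  moreover from this have "map (map_prod id (cell_map h)) l = l"
    using Suc.IH by (intro map_idI) (auto simp: in_lists_conv_set)
  ultimately show ?case by simp
qed

lemma (in free_resolution) res_map_id:
  assumes h: "\<And>x. x \<in> carrier M \<Longrightarrow> h x = x" and v: "v \<in> carrier (F i)"
  shows "res_map R h v = v"
proof -
  interpret h: resolution_map R M M h
    by unfold_locales (auto simp: mod_hom_def h)
  show ?thesis
  proof (rule free_module_hom_eqI[OF module_F[of i], where B = "res_basis R M i" and g = "\<lambda>v. v"])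
    show "res_map R h \<in> mod_hom R (free_module R (res_basis R M i)) (F i)"
      using h.res_map_hom[of i] by (simp add: F_def)
    show "(\<lambda>v. v) \<in> mod_hom R (free_module R (res_basis R M i)) (F i)"
      by (auto simp: mod_hom_def F_def)
    show "res_map R h (delta R b) = delta R b" if "b \<in> res_basis R M i" for b
      using h.res_map_delta[OF that] cell_map_id_on_basis[OF h that] by simp
    show "v \<in> carrier (free_module R (res_basis R M i))"
      using v by (simp add: F_def)
  qed
qed

section \<open>Contraction onto a finitely generated subresolution\<close>

text \<open>The vectors congruent to their image under \<open>p\<close> modulo \<open>G\<close>. As
  they form a submodule, such a congruence may be checked on basis vectors.\<close>

lemma submodule_congruent:
  assumes A: "Module.module R A" and G: "submodule G R A" and p: "p \<in> mod_hom R A A"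
  shows "submodule {v \<in> carrier A. \<exists>g\<in>G. v = g \<oplus>\<^bsub>A\<^esub> p v} R A"
proof -
  interpret A: Module.module R A by fact
  note GE = A.submoduleE[OF G]
  show ?thesis
  proof (rule A.submoduleI'; clarsimp)
    show "\<exists>g\<in>G. \<zero>\<^bsub>A\<^esub> = g \<oplus>\<^bsub>A\<^esub> p \<zero>\<^bsub>A\<^esub>"
      using submodule_zero_closed[OF G] mod_hom_zero[OF A A p] by force
  next
    fix x y g g'
    assume x: "x \<in> carrier A" "g \<in> G" "x = g \<oplus>\<^bsub>A\<^esub> p x" and y: "y \<in> carrier A" "g' \<in> G" "y = g' \<oplus>\<^bsub>A\<^esub> p y"
    have c: "g \<in> carrier A" "g' \<in> carrier A" "p x \<in> carrier A" "p y \<in> carrier A"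
      using x y GE(1) mod_hom_closed[OF p] by auto
    have "x \<oplus>\<^bsub>A\<^esub> y = (g \<oplus>\<^bsub>A\<^esub> p x) \<oplus>\<^bsub>A\<^esub> (g' \<oplus>\<^bsub>A\<^esub> p y)"
      using x(3) y(3) by simp
    also have "\<dots> = (g \<oplus>\<^bsub>A\<^esub> g') \<oplus>\<^bsub>A\<^esub> p (x \<oplus>\<^bsub>A\<^esub> y)"
      using c mod_hom_add[OF p x(1) y(1)] by (simp add: A.M.a_ac)
    finally show "\<exists>g\<in>G. x \<oplus>\<^bsub>A\<^esub> y = g \<oplus>\<^bsub>A\<^esub> p (x \<oplus>\<^bsub>A\<^esub> y)"
      using GE(5)[OF x(2) y(2)] by blast
  next
    fix r x g
    assume r: "r \<in> carrier R" and x: "x \<in> carrier A" "g \<in> G" "x = g \<oplus>\<^bsub>A\<^esub> p x"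
    have c: "g \<in> carrier A" "p x \<in> carrier A"
      using x GE(1) mod_hom_closed[OF p] by auto
    have "r \<odot>\<^bsub>A\<^esub> x = r \<odot>\<^bsub>A\<^esub> (g \<oplus>\<^bsub>A\<^esub> p x)"
      using x(3) by simp
    also have "\<dots> = (r \<odot>\<^bsub>A\<^esub> g) \<oplus>\<^bsub>A\<^esub> p (r \<odot>\<^bsub>A\<^esub> x)"
      using c r mod_hom_smult[OF p r x(1)] by (simp add: A.smult_r_distr)
    finally show "\<exists>g\<in>G. r \<odot>\<^bsub>A\<^esub> x = g \<oplus>\<^bsub>A\<^esub> p (r \<odot>\<^bsub>A\<^esub> x)"
      using GE(4)[OF r x(2)] by blast
  qed
qed

text \<open>\<open>S_aug\<close> expresses that the span of \<open>S 0\<close> already maps onto the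
  image of the augmentation, in the form of a sum with the kernel. \<open>S_exact\<close> is
  exactness of the span of \<open>S\<close> in degree \<open>i\<close>, for every
  \<open>i\<close>.\<close>

locale subresolution = free_resolution R M
  for R :: "('a, 'r) ring_scheme" (structure) and M :: "('a, 'm, 'x) module_scheme" (structure) +
  fixes S :: "nat \<Rightarrow> ('a, 'm) cell set"
  assumes S_basis: "\<And>i. S i \<subseteq> res_basis R M i"
    and S_aug: "\<And>v. v \<in> carrier (F 0) \<Longrightarrow>
      \<exists>g \<in> carrier (free_module R (S 0)). \<exists>k \<in> K 0. v = g \<oplus>\<^bsub>F 0\<^esub> k"
    and S_exact: "\<And>i v. v \<in> carrier (free_module R (S i)) \<Longrightarrow> v \<in> K i \<Longrightarrow>
      \<exists>u \<in> carrier (free_module R (S (Suc i))). bdry u = v"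
begin

abbreviation "G i \<equiv> carrier (free_module R (S i))"

lemma G_F: "v \<in> G i \<Longrightarrow> v \<in> carrier (F i)"
  unfolding F_def using free_module_carrier_mono[OF S_basis] .

lemma submodule_G: "submodule (G i) R (F i)"
proof -
  interpret F: Module.module R "F i" by (rule module_F)
  interpret G: Module.module R "free_module R (S i)" by (rule free_module_module)
  show ?thesis
    using G.zero_closed G.a_closed G.smult_closed
    by (intro F.submoduleI') (auto simp: F_def intro: G_F[unfolded F_def])
qed

text \<open>
  The maps \<open>s\<close> below form a contracting homotopy of \<open>F/G\<close>; congruence modulo \<open>G\<close> is expressed by a
  summand in \<open>G\<close>, to avoid subtraction.
\<close>

lemma contraction_extend:
  assumes \<theta>: "\<theta> \<in> mod_hom R (F i) (F i)"
    and ex: "\<And>v. v \<in> carrier (F i) \<Longrightarrow>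
      \<exists>g \<in> G i. \<exists>x \<in> carrier (F (Suc i)). v = g \<oplus>\<^bsub>F i\<^esub> (\<theta> v \<oplus>\<^bsub>F i\<^esub> bdry x)"
  shows "\<exists>s \<in> mod_hom R (F i) (F (Suc i)). \<forall>v \<in> carrier (F i).
    \<exists>g \<in> G i. v = g \<oplus>\<^bsub>F i\<^esub> (\<theta> v \<oplus>\<^bsub>F i\<^esub> bdry (s v))"
proof -
  interpret F: Module.module R "F i" by (rule module_F)
  let ?B = "res_basis R M i"
  have d: "delta R c \<in> carrier (F i)" if "c \<in> ?B" for c
    using that by (simp add: F_def delta_closed)
  \<comment> \<open>The \<open>x\<close> supplied by \<open>ex\<close> need not depend linearly on
    \<open>v\<close>, so it is chosen on basis vectors only and extended by freeness.\<close>
  obtain \<sigma> where \<sigma>: "\<And>c. c \<in> ?B \<Longrightarrow> \<sigma> c \<in> carrier (F (Suc i)) \<and>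
      (\<exists>g \<in> G i. delta R c = g \<oplus>\<^bsub>F i\<^esub> (\<theta> (delta R c) \<oplus>\<^bsub>F i\<^esub> bdry (\<sigma> c)))"
    using ex[OF d] by metis
  define s where "s = free_ext R (F (Suc i)) \<sigma>"
  have s: "s \<in> mod_hom R (F i) (F (Suc i))"
    unfolding s_def using free_ext_hom[OF module_F, of ?B \<sigma>] \<sigma> by (simp add: F_def[of i])
  have sd: "s (delta R c) = \<sigma> c" if "c \<in> ?B" for c
    unfolding s_def using free_ext_delta[OF module_F, of \<sigma> c] \<sigma>[OF that] by simp
  define p where "p v = \<theta> v \<oplus>\<^bsub>F i\<^esub> bdry (s v)" for v
  have bs: "(\<lambda>v. bdry (s v)) \<in> mod_hom R (F i) (F i)"
    by (rule mod_hom_comp[OF s diff_hom])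
  have p: "p \<in> mod_hom R (F i) (F i)"
    unfolding p_def
    using mod_hom_closed[OF \<theta>] mod_hom_closed[OF bs] mod_hom_add[OF \<theta>] mod_hom_add[OF bs]
      mod_hom_smult[OF \<theta>] mod_hom_smult[OF bs]
    by (intro mod_homI) (auto simp: F.M.a_ac F.smult_r_distr simp del: F.M.add.m_assoc)
  have "v \<in> {v \<in> carrier (F i). \<exists>g\<in>G i. v = g \<oplus>\<^bsub>F i\<^esub> p v}" if v: "v \<in> carrier (F i)" for v
  proof (rule free_module_hom_in_submodule[OF module_F _ submodule_congruent[OF module_F submodule_G p], of "\<lambda>v. v" ?B])
    show "(\<lambda>v. v) \<in> mod_hom R (free_module R ?B) (F i)"
      by (auto simp: mod_hom_def F_def)
    show "v \<in> carrier (free_module R ?B)" using v by (simp add: F_def)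
    fix c assume c: "c \<in> ?B"
    show "delta R c \<in> {v \<in> carrier (F i). \<exists>g\<in>G i. v = g \<oplus>\<^bsub>F i\<^esub> p v}"
      using \<sigma>[OF c] d[OF c] by (simp add: p_def sd[OF c])
  qed
  then show ?thesis
    using s unfolding p_def by blast
qed

text \<open>Exactness of \<open>F/G\<close>, chased by hand. By \<open>sK\<close>, the boundary of
  \<open>v - s (bdry v)\<close> is some \<open>g0\<close> in \<open>G j\<close>, and it is a cycle.
  By \<open>S_exact\<close> it is also the boundary of some \<open>g\<close> in
  \<open>G (Suc j)\<close>. What remains after subtracting \<open>g\<close> is a cycle, hence a
  boundary \<open>bdry x\<close>.\<close>

lemma contraction_step:
  assumes s: "s \<in> mod_hom R (F j) (F (Suc j))"
    and sK: "\<And>u. u \<in> K j \<Longrightarrow> \<exists>g\<in>G j. u = g \<oplus>\<^bsub>F j\<^esub> bdry (s u)"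
    and v: "v \<in> carrier (F (Suc j))"
  shows "\<exists>g\<in>G (Suc j). \<exists>x \<in> carrier (F (Suc (Suc j))).
    v = g \<oplus>\<^bsub>F (Suc j)\<^esub> (s (bdry v) \<oplus>\<^bsub>F (Suc j)\<^esub> bdry x)"
proof -
  let ?F = "F (Suc j)" and ?E = "F j"
  interpret F: Module.module R ?F by (rule module_F)
  interpret E: Module.module R ?E by (rule module_F)
  note hom = mod_hom_add[OF diff_hom[of j]] and cl = mod_hom_closed[OF diff_hom[of j]]
  define u where "u = bdry v"
  have u: "u \<in> K j" "u \<in> carrier ?E" unfolding u_def using diff_in_K[OF v] K_subset by auto
  obtain g0 where g0: "g0 \<in> G j" "u = g0 \<oplus>\<^bsub>?E\<^esub> bdry (s u)" using sK[OF u(1)] by blast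
  have su: "s u \<in> carrier ?F" using mod_hom_closed[OF s u(2)] .
  define w where "w = \<ominus>\<^bsub>?F\<^esub> s u \<oplus>\<^bsub>?F\<^esub> v"
  have w: "w \<in> carrier ?F" and vw: "v = s u \<oplus>\<^bsub>?F\<^esub> w"
    using su v by (simp_all add: w_def F.M.r_neg2)
  have "bdry v = bdry (s u) \<oplus>\<^bsub>?E\<^esub> bdry w"
    using hom[OF su w] unfolding vw[symmetric] .
  then have "bdry (s u) \<oplus>\<^bsub>?E\<^esub> bdry w = u"
    by (simp add: u_def)
  also have "u = bdry (s u) \<oplus>\<^bsub>?E\<^esub> g0"
    using g0(2) unfolding E.M.a_comm[OF cl[OF su] G_F[OF g0(1)]] .
  finally have bw: "bdry w = g0"
    using cl[OF su] cl[OF w] G_F[OF g0(1)] by (metis E.M.add.l_cancel)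
  then have "g0 \<in> K j" using diff_in_K[OF w] by simp
  then obtain g where g: "g \<in> G (Suc j)" "bdry g = g0" using S_exact[OF g0(1)] by blast
  have gF: "g \<in> carrier ?F" using G_F[OF g(1)] .
  define k where "k = \<ominus>\<^bsub>?F\<^esub> g \<oplus>\<^bsub>?F\<^esub> w"
  have k: "k \<in> carrier ?F" and wk: "w = g \<oplus>\<^bsub>?F\<^esub> k"
    using gF w by (simp_all add: k_def F.M.r_neg2)
  have "g0 \<oplus>\<^bsub>?E\<^esub> bdry k = g0"
    using hom[OF gF k] wk bw g(2) by simp
  then have "bdry k = \<zero>\<^bsub>?E\<^esub>"
    using E.M.add.l_cancel_one[of g0 "bdry k"] cl[OF k] G_F[OF g0(1)] by simp
  then have "k \<in> K (Suc j)" using k by (simp add: res_ker_def F_def)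
  then obtain x where x: "x \<in> carrier (F (Suc (Suc j)))" "bdry x = k" using K_exact by blast
  have "v = g \<oplus>\<^bsub>?F\<^esub> (s (bdry v) \<oplus>\<^bsub>?F\<^esub> bdry x)"
    using vw[unfolded wk] gF su k unfolding x(2) u_def[symmetric] by (simp add: F.M.a_lcomm)
  then show ?thesis using g(1) x(1) by blast
qed

text \<open>Modulo \<open>G\<close> the next homotopy \<open>s'\<close> satisfies
  \<open>v = s (bdry v) + bdry (s' v)\<close>. On cycles the first term vanishes, and the relation
  on cycles is all that the following step requires.\<close>

lemma contraction:
  "\<exists>s \<in> mod_hom R (F j) (F (Suc j)). \<forall>u \<in> K j. \<exists>g\<in>G j. u = g \<oplus>\<^bsub>F j\<^esub> bdry (s u)"
proof (induction j)
  case 0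
  interpret F: Module.module R "F 0" by (rule module_F)
  \<comment> \<open>No homotopy precedes degree 0, so \<open>\<theta>\<close> is zero: by
    \<open>S_aug\<close> every vector of \<open>F 0\<close> is congruent to a boundary.\<close>
  have z: "(\<lambda>_. \<zero>\<^bsub>F 0\<^esub>) \<in> mod_hom R (F 0) (F 0)" by (rule mod_homI) auto
  have b: "bdry x \<in> carrier (F 0)" if "x \<in> carrier (F (Suc 0))" for x
    using mod_hom_closed[OF diff_hom that] .
  have "\<exists>g \<in> G 0. \<exists>x \<in> carrier (F (Suc 0)). v = g \<oplus>\<^bsub>F 0\<^esub> (\<zero>\<^bsub>F 0\<^esub> \<oplus>\<^bsub>F 0\<^esub> bdry x)"
    if "v \<in> carrier (F 0)" for v
  proof -
    obtain g k where gk: "g \<in> G 0" "k \<in> K 0" "v = g \<oplus>\<^bsub>F 0\<^esub> k" using S_aug[OF \<open>v \<in> carrier (F 0)\<close>] by blast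
    obtain x where "x \<in> carrier (F (Suc 0))" "bdry x = k" using K_exact[OF gk(2)] by blast
    then show ?thesis using gk b by (metis F.M.l_zero)
  qed
  from contraction_extend[OF z this] obtain s where s: "s \<in> mod_hom R (F 0) (F (Suc 0))"
    "\<And>v. v \<in> carrier (F 0) \<Longrightarrow> \<exists>g \<in> G 0. v = g \<oplus>\<^bsub>F 0\<^esub> (\<zero>\<^bsub>F 0\<^esub> \<oplus>\<^bsub>F 0\<^esub> bdry (s v))"
    by blast
  have "\<exists>g\<in>G 0. u = g \<oplus>\<^bsub>F 0\<^esub> bdry (s u)" if "u \<in> K 0" for u
  proof -
    have u: "u \<in> carrier (F 0)" using that K_subset by blast
    show ?thesis using s(2)[OF u] F.M.l_zero[OF b[OF mod_hom_closed[OF s(1) u]]] by simp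
  qed
  then show ?case using s(1) by blast
next
  case (Suc j)
  interpret F: Module.module R "F (Suc j)" by (rule module_F)
  obtain s where s: "s \<in> mod_hom R (F j) (F (Suc j))"
    "\<And>u. u \<in> K j \<Longrightarrow> \<exists>g\<in>G j. u = g \<oplus>\<^bsub>F j\<^esub> bdry (s u)"
    using Suc by blast
  obtain s' where s': "s' \<in> mod_hom R (F (Suc j)) (F (Suc (Suc j)))"
    "\<And>v. v \<in> carrier (F (Suc j)) \<Longrightarrow>
      \<exists>g \<in> G (Suc j). v = g \<oplus>\<^bsub>F (Suc j)\<^esub> (s (bdry v) \<oplus>\<^bsub>F (Suc j)\<^esub> bdry (s' v))"
    using contraction_extend[OF mod_hom_comp[OF diff_hom s(1)] contraction_step[OF s]] by blast
  have "\<exists>g\<in>G (Suc j). u = g \<oplus>\<^bsub>F (Suc j)\<^esub> bdry (s' u)" if "u \<in> K (Suc j)" for u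
  proof -
    have u: "u \<in> carrier (F (Suc j))" "bdry u = \<zero>\<^bsub>F j\<^esub>"
      using that by (auto simp: res_ker_def F_def)
    have "s (bdry u) = \<zero>\<^bsub>F (Suc j)\<^esub>"
      unfolding u(2) by (rule mod_hom_zero[OF module_F module_F s(1)])
    then show ?thesis
      using s'(2)[OF u(1)] F.M.l_zero[OF mod_hom_closed[OF diff_hom mod_hom_closed[OF s'(1) u(1)]]] by simp
  qed
  then show ?case using s'(1) by blast
qed

text \<open>Apply \<open>f\<close> to \<open>v = g + (s (bdry v) + bdry x)\<close>: it kills
  \<open>g\<close>, which lies in the span of \<open>S i\<close>, and the boundary, so
  \<open>f v = f (s (bdry v))\<close> and \<open>f\<close> composed with \<open>s\<close> is the
  required cochain. In degree 0 there are no coboundaries except zero, and \<open>f\<close> vanishes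
  since \<open>F 0\<close> is the span of \<open>S 0\<close> plus boundaries.\<close>

lemma cocycle_vanishing_on_S:
  assumes N: "Module.module R N" and f: "f \<in> mod_hom R (F i) N"
    and cocycle: "\<And>v. v \<in> carrier (F (Suc i)) \<Longrightarrow> f (bdry v) = \<zero>\<^bsub>N\<^esub>"
    and fS: "\<And>b. b \<in> S i \<Longrightarrow> f (delta R b) = \<zero>\<^bsub>N\<^esub>"
  shows "if i = 0 then \<forall>v \<in> carrier (F 0). f v = \<zero>\<^bsub>N\<^esub>
    else \<exists>g \<in> mod_hom R (F (i - 1)) N. \<forall>v \<in> carrier (F i). f v = g (bdry v)"
proof -
  interpret N: Module.module R N by fact
  have "submodule {\<zero>\<^bsub>N\<^esub>} R N" by (rule N.submoduleI') auto
  moreover have "f \<in> mod_hom R (free_module R (S i)) N"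
    using f G_F by (auto simp: mod_hom_def F_def)
  ultimately have fG: "f v = \<zero>\<^bsub>N\<^esub>" if "v \<in> G i" for v
    using free_module_hom_in_submodule[OF N, of f "S i" "{\<zero>\<^bsub>N\<^esub>}" v] fS that by auto
  show ?thesis
  proof (cases i)
    case 0
    have "f v = \<zero>\<^bsub>N\<^esub>" if "v \<in> carrier (F 0)" for v
    proof -
      obtain g k where gk: "g \<in> G 0" "k \<in> K 0" "v = g \<oplus>\<^bsub>F 0\<^esub> k" using S_aug[OF \<open>v \<in> carrier (F 0)\<close>] by blast
      obtain x where x: "x \<in> carrier (F (Suc 0))" "bdry x = k" using K_exact[OF gk(2)] by blast
      have "g \<in> carrier (F 0)" "k \<in> carrier (F 0)" using gk G_F K_subset by auto
      then have "f v = f g \<oplus>\<^bsub>N\<^esub> f k" using f gk(3) 0 by (auto simp: mod_hom_def)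
      then show ?thesis using fG gk(1) cocycle x 0 by auto
    qed
    then show ?thesis using 0 by simp
  next
    case (Suc j)
    interpret F: Module.module R "F (Suc j)" by (rule module_F)
    obtain s where s: "s \<in> mod_hom R (F j) (F (Suc j))"
      "\<And>u. u \<in> K j \<Longrightarrow> \<exists>g\<in>G j. u = g \<oplus>\<^bsub>F j\<^esub> bdry (s u)"
      using contraction by blast
    have "f v = f (s (bdry v))" if v: "v \<in> carrier (F (Suc j))" for v
    proof -
      obtain g x where gx: "g \<in> G (Suc j)" "x \<in> carrier (F (Suc (Suc j)))"
        "v = g \<oplus>\<^bsub>F (Suc j)\<^esub> (s (bdry v) \<oplus>\<^bsub>F (Suc j)\<^esub> bdry x)"
        using contraction_step[OF s v] by blast
      have c: "g \<in> carrier (F i)" "s (bdry v) \<in> carrier (F i)" "bdry x \<in> carrier (F i)"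
        using G_F[OF gx(1)] mod_hom_closed[OF s(1) mod_hom_closed[OF diff_hom v]]
          mod_hom_closed[OF diff_hom gx(2)] Suc by auto
      have "f v = f g \<oplus>\<^bsub>N\<^esub> (f (s (bdry v)) \<oplus>\<^bsub>N\<^esub> f (bdry x))"
        using gx(3) mod_hom_add[OF f c(2,3)] mod_hom_add[OF f c(1), of "s (bdry v) \<oplus>\<^bsub>F i\<^esub> bdry x"]
          F.M.a_closed c Suc by simp
      then show ?thesis
        using fG gx(1,2) cocycle Suc mod_hom_closed[OF f c(2)] by simp
    qed
    moreover have "(\<lambda>u. f (s u)) \<in> mod_hom R (F j) N"
      using mod_hom_comp[OF s(1) f[unfolded Suc]] .
    ultimately show ?thesis using Suc by auto
  qed
qed

end

section \<open>Finite generation of Ext\<close>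

context free_resolution
begin

text \<open>The cycles in the span of \<open>S\<close> form a submodule of a free module of finite
  rank. Each of finitely many generators \<open>t\<close> is written as a list over
  \<open>S\<close>, and the cells of these lists make up \<open>S'\<close>.\<close>

lemma finite_subresolution_step:
  assumes noeth: "noetherian_ring R" and S: "finite S" "S \<subseteq> res_basis R M i"
  shows "\<exists>S'. finite S' \<and> S' \<subseteq> res_basis R M (Suc i) \<and>
    (\<forall>v \<in> carrier (free_module R S) \<inter> K i. \<exists>u \<in> carrier (free_module R S'). bdry u = v)"
proof -
  let ?G = "free_module R S"
  have G: "Module.module R ?G" by (rule free_module_module)
  interpret G: Module.module R ?G by (rule G)
  have incl: "(\<lambda>v. v) \<in> mod_hom R ?G (F i)"
    using free_module_carrier_mono[OF S(2)] by (auto simp: mod_hom_def F_def)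
  let ?H = "{v \<in> carrier ?G. v \<in> K i}"
  have H: "submodule ?H R ?G"
    by (rule submodule_vimage[OF G module_F incl submodule_K G.carrier_is_submodule])
  obtain T where T: "finite T" "T \<subseteq> ?H" "gen_submodule R ?G T = ?H"
    by (rule noetherian_moduleE[OF free_module_noetherian[OF R.cring_axioms noeth S(1)] H])
  have "\<exists>l \<in> lists (carrier R \<times> S). t = lincomb R l" if "t \<in> T" for t
    using T(2) that by (intro lincomb_surj) auto
  then obtain l where l: "\<And>t. t \<in> T \<Longrightarrow> l t \<in> lists (carrier R \<times> S) \<and> t = lincomb R (l t)"
    by metis
  let ?S' = "(\<lambda>t. Rel (l t)) ` T"
  have bd: "cell_bd R ` ?S' = T"
    using l by (force simp: image_iff)
  have S': "?S' \<subseteq> res_basis R M (Suc i)"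
  proof (rule image_subsetI)
    fix t assume t: "t \<in> T"
    then have "l t \<in> lists (carrier R \<times> res_basis R M i)"
      using l S(2) by (fastforce simp: in_lists_conv_set)
    moreover have "lincomb R (l t) \<in> K i" using t l T(2) by auto
    ultimately show "Rel (l t) \<in> res_basis R M (Suc i)" by (simp add: Rel_basis_iff)
  qed
  have bdG: "cell_bd R c \<in> carrier ?G" if "c \<in> ?S'" for c
    using that bd T(2) by blast
  have "free_ext R ?G (cell_bd R) ` carrier (free_module R ?S') = ?H"
    using free_ext_image[OF G, of ?S' "cell_bd R", OF bdG] bd T(3) by simp
  \<comment> \<open>As the lists have entries in \<open>S\<close>, boundaries can be computed inside
    \<open>?G\<close>, where the span of \<open>T\<close> is exactly \<open>?H\<close>.\<close>
  moreover have "bdry u = free_ext R ?G (cell_bd R) u" if "u \<in> carrier (free_module R ?S')" for u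
    by (rule res_diff_eq[OF that bdG])
  ultimately have im: "bdry ` carrier (free_module R ?S') = ?H" by simp
  have "\<exists>u \<in> carrier (free_module R ?S'). bdry u = v" if "v \<in> carrier ?G \<inter> K i" for v
  proof -
    have "v \<in> bdry ` carrier (free_module R ?S')" using that by (simp add: im)
    then show ?thesis by blast
  qed
  then show ?thesis
    using T(1) S' by blast
qed

lemma finite_subresolution:
  assumes noeth: "noetherian_ring R" and fg: "fg_module R M"
  shows "\<exists>S. (\<forall>i. finite (S i)) \<and> subresolution R M S"
proof -
  obtain T where T: "finite T" "T \<subseteq> carrier M" "gen_submodule R M T = carrier M"
    using fg by (auto simp: fg_module_def)
  let ?P = "\<lambda>i S. finite S \<and> S \<subseteq> res_basis R M i \<and> (i = 0 \<longrightarrow> S = Gen ` T)"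
  let ?Q = "\<lambda>i S S'. \<forall>v \<in> carrier (free_module R S) \<inter> K i. \<exists>u \<in> carrier (free_module R S'). bdry u = v"
  \<comment> \<open>Each set depends on the previous one, so dependent choice is needed. The clause
    for \<open>i = 0\<close> in \<open>?P\<close> retains the link with the generators
    \<open>T\<close> of \<open>M\<close>.\<close>
  have "\<exists>S. \<forall>i. ?P i (S i) \<and> ?Q i (S i) (S (Suc i))"
  proof (rule dependent_nat_choice)
    show "\<exists>S. ?P 0 S" using T by auto
    fix S i assume "?P i S"
    then show "\<exists>S'. ?P (Suc i) S' \<and> ?Q i S S'"
      using finite_subresolution_step[OF noeth, of S i] by simp
  qed
  then obtain S where PQ: "\<forall>i. ?P i (S i) \<and> ?Q i (S i) (S (Suc i))" ..
  then have S: "?P i (S i)" "?Q i (S i) (S (Suc i))" for i by blast+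
  have "subresolution R M S"
  proof
    fix v assume v: "v \<in> carrier (F 0)"
    interpret F: Module.module R "F 0" by (rule module_F)
    have S0: "S 0 = Gen ` T" using S(1)[of 0] by simp
    have "free_ext R M (cell_aug M) ` carrier (free_module R (S 0)) = gen_submodule R M (cell_aug M ` S 0)"
      using T(2) S0 by (intro free_ext_image module_axioms) auto
    moreover have "cell_aug M ` S 0 = T" by (auto simp: S0 image_image)
    ultimately have "res_aug R M v \<in> res_aug R M ` carrier (free_module R (S 0))"
      using T(3) mod_hom_closed[OF aug_hom v] by (simp add: res_aug_eq)
    then obtain g where g: "g \<in> carrier (free_module R (S 0))" "res_aug R M g = res_aug R M v" by auto
    have "S 0 \<subseteq> res_basis R M 0" using S(1)[of 0] by blast
    then have gF: "g \<in> carrier (F 0)"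
      unfolding F_def using g(1) by (rule free_module_carrier_mono)
    \<comment> \<open>\<open>g\<close> was chosen with the same augmentation as \<open>v\<close>, so
      the difference is in the kernel.\<close>
    define k where "k = \<ominus>\<^bsub>F 0\<^esub> g \<oplus>\<^bsub>F 0\<^esub> v"
    have k: "k \<in> carrier (F 0)" "v = g \<oplus>\<^bsub>F 0\<^esub> k"
      using gF v by (simp_all add: k_def F.M.r_neg2)
    have "res_aug R M v = res_aug R M v \<oplus>\<^bsub>M\<^esub> res_aug R M k"
      using mod_hom_add[OF aug_hom gF k(1)] g(2) unfolding k(2)[symmetric] by simp
    then have "res_aug R M k = \<zero>\<^bsub>M\<^esub>"
      using mod_hom_closed[OF aug_hom v] mod_hom_closed[OF aug_hom k(1)]
        M.add.l_cancel_one'[of "res_aug R M v" "res_aug R M k"] by simp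
    then have "k \<in> K 0" using k(1) by (simp add: res_ker_def)
    then show "\<exists>g\<in>carrier (free_module R (S 0)). \<exists>k\<in>K 0. v = g \<oplus>\<^bsub>F 0\<^esub> k"
      using g(1) k(2) by blast
  qed (use S in auto)
  then show ?thesis using S(1) by blast
qed

lemma cochain_ext_complex:
  assumes N: "Module.module R N"
  shows "cochain_complex R (ext_complex R M N) (ext_diff R M)"
proof (rule cochain_complex.intro)
  show "Module.module R (ext_complex R M N i)" for i
    unfolding ext_complex_def by (rule hom_module_module[OF module_F N])
  interpret N: Module.module R N by fact
  fix i
  interpret F: Module.module R "F (Suc i)" by (rule module_F)
  have b: "bdry v \<in> carrier (F i)" if "v \<in> carrier (F (Suc i))" for v
    using mod_hom_closed[OF diff_hom that] .
  have c: "ext_diff R M i f \<in> carrier (hom_module R (F (Suc i)) N)" if "f \<in> mod_hom R (F i) N" for f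
    using restrict_mod_hom[OF module_F mod_hom_comp[OF diff_hom that]]
    by (simp add: ext_diff_def)
  show "ext_diff R M i \<in> mod_hom R (ext_complex R M N i) (ext_complex R M N (Suc i))"
    unfolding ext_complex_def
  proof (rule mod_homI)
    fix f assume "f \<in> carrier (hom_module R (F i) N)"
    then have "f \<in> mod_hom R (F i) N" by simp
    then show "ext_diff R M i f \<in> carrier (hom_module R (F (Suc i)) N)" by (rule c)
  qed (auto simp: ext_diff_def b intro!: restrict_ext)
  fix f assume "f \<in> carrier (ext_complex R M N i)"
  then have f: "f \<in> mod_hom R (F i) N" by (simp add: ext_complex_def)
  have "bdry v \<in> carrier (F (Suc i))" if "v \<in> carrier (F (Suc (Suc i)))" for v
    using mod_hom_closed[OF diff_hom that] .
  then show "ext_diff R M (Suc i) (ext_diff R M i f) = \<zero>\<^bsub>ext_complex R M N (Suc (Suc i))\<^esub>"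
    by (auto simp: ext_diff_def ext_complex_def diff_diff mod_hom_zero[OF module_F N f] intro!: restrict_ext)
qed

lemma Ext_fg:
  assumes noeth: "noetherian_ring R" and M: "fg_module R M" and N: "fg_module R N"
  shows "fg_module R (Ext R i M N)"
proof -
  obtain S where S: "\<And>i. finite (S i)" "subresolution R M S"
    using finite_subresolution[OF noeth M] by auto
  interpret subresolution R M S by (rule S)
  have Nm: "Module.module R N" using N by (simp add: fg_module_def)
  interpret N: Module.module R N by (rule Nm)
  let ?C = "ext_complex R M N" and ?d = "ext_diff R M"
  interpret C: cochain_complex R ?C ?d by (rule cochain_ext_complex[OF Nm])
  have del: "delta R b \<in> carrier (F i)" if "b \<in> S i" for b
    using that S_basis by (auto simp: F_def intro!: delta_closed)
  \<comment> \<open>These evaluations play the part of \<open>\<rho>\<close> in the decomposition of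
    the cocycles; its remainders are then coboundaries by \<open>kB\<close>.\<close>
  have \<rho>: "(\<lambda>f. f (delta R b)) \<in> mod_hom R (C.cocycle_module i) N" if "b \<in> S i" for b
    using C.submodule_cocycles[of i] del[OF that]
    by (intro mod_homI) (auto simp: cocycles_def ext_complex_def mod_hom_closed)
  have Z: "submodule (cocycles ?C ?d i) R (C.cocycle_module i)"
    using Module.module.carrier_is_submodule[OF C.module_cocycles[of i]] by simp
  have "\<exists>T. finite T \<and> T \<subseteq> cocycles ?C ?d i \<and> (\<forall>z \<in> cocycles ?C ?d i.
      \<exists>t\<in>gen_submodule R (C.cocycle_module i) T. \<exists>k\<in>cocycles ?C ?d i.
        (\<forall>b\<in>S i. k (delta R b) = \<zero>\<^bsub>N\<^esub>) \<and> z = t \<oplus>\<^bsub>C.cocycle_module i\<^esub> k)"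
    by (rule noetherian_decomposition[where \<rho> = "\<lambda>b f. f (delta R b)", OF C.module_cocycles[of i]
      fg_module_noetherian[OF R.cring_axioms noeth N] S(1)[of i] \<rho> Z])
  then obtain T where T: "finite T" "T \<subseteq> cocycles ?C ?d i"
    "\<forall>z \<in> cocycles ?C ?d i. \<exists>t\<in>gen_submodule R (C.cocycle_module i) T.
      \<exists>k\<in>cocycles ?C ?d i. (\<forall>b\<in>S i. k (delta R b) = \<zero>\<^bsub>N\<^esub>) \<and> z = t \<oplus>\<^bsub>C.cocycle_module i\<^esub> k"
    by (elim exE conjE)
  have kB: "k \<in> coboundaries ?C ?d i"
    if k: "k \<in> cocycles ?C ?d i" and kS: "\<And>b. b \<in> S i \<Longrightarrow> k (delta R b) = \<zero>\<^bsub>N\<^esub>" for k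
  proof -
    have kh: "k \<in> mod_hom R (F i) N" and ke: "k \<in> extensional (carrier (F i))"
      using k by (auto simp: cocycles_def ext_complex_def)
    have dk: "?d i k = (\<lambda>v \<in> carrier (F (Suc i)). \<zero>\<^bsub>N\<^esub>)"
      using k by (simp add: cocycles_def ext_complex_def)
    have "k (bdry v) = \<zero>\<^bsub>N\<^esub>" if "v \<in> carrier (F (Suc i))" for v
      using fun_cong[OF dk, of v] that by (simp add: ext_diff_def)
    from cocycle_vanishing_on_S[OF Nm kh this kS]
    have *: "if i = 0 then \<forall>v \<in> carrier (F 0). k v = \<zero>\<^bsub>N\<^esub>
      else \<exists>g \<in> mod_hom R (F (i - 1)) N. \<forall>v \<in> carrier (F i). k v = g (bdry v)" .
    show ?thesis
    proof (cases i)
      case 0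
      then have "k = (\<lambda>v \<in> carrier (F 0). \<zero>\<^bsub>N\<^esub>)"
        using * ke by (intro extensionalityI[of _ "carrier (F 0)"]) auto
      then show ?thesis using 0 by (simp add: coboundaries_def ext_complex_def)
    next
      case (Suc j)
      then obtain g where g: "g \<in> mod_hom R (F j) N" "\<And>v. v \<in> carrier (F i) \<Longrightarrow> k v = g (bdry v)"
        using * by auto
      have "bdry v \<in> carrier (F j)" if "v \<in> carrier (F i)" for v
        using mod_hom_closed[OF diff_hom] that Suc by blast
      \<comment> \<open>Only the restriction of \<open>g\<close> is a cochain; since
        \<open>bdry\<close> maps into \<open>F j\<close>, it has the same coboundary.\<close>
      then have "k = ?d j (restrict g (carrier (F j)))"
        using g(2) ke Suc by (intro extensionalityI[of _ "carrier (F i)"]) (auto simp: ext_diff_def)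
      moreover have "restrict g (carrier (F j)) \<in> carrier (?C j)"
        using restrict_mod_hom[OF module_F g(1)] by (simp add: ext_complex_def)
      ultimately show ?thesis using Suc by (simp add: coboundaries_def)
    qed
  qed
  show ?thesis
    unfolding Ext_def
  proof (rule C.cohomology_fg[OF T(1,2)])
    fix z assume "z \<in> cocycles ?C ?d i"
    with T(3) obtain t k where "t \<in> gen_submodule R (C.cocycle_module i) T"
      "k \<in> cocycles ?C ?d i" "\<And>b. b \<in> S i \<Longrightarrow> k (delta R b) = \<zero>\<^bsub>N\<^esub>" "z = t \<oplus>\<^bsub>C.cocycle_module i\<^esub> k"
      by metis
    then show "\<exists>t\<in>gen_submodule R (C.cocycle_module i) T.
        \<exists>k\<in>coboundaries ?C ?d i. z = t \<oplus>\<^bsub>?C i\<^esub> k"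
      using kB[of k] by auto
  qed
qed

lemma Ext_module: "Module.module R N \<Longrightarrow> Module.module R (Ext R i M N)"
  unfolding Ext_def by (rule cochain_complex.module_cohomology[OF cochain_ext_complex])

end

section \<open>Contravariant functoriality of Ext in the first argument\<close>

context resolution_map
begin

context
  fixes N :: "('a, 'n, 'z) module_scheme"
  assumes N: "Module.module R N"
begin

interpretation C: cochain_complex R "ext_complex R M N" "ext_diff R M"
  by (rule M.cochain_ext_complex[OF N])

interpretation C': cochain_complex R "ext_complex R M' N" "ext_diff R M'"
  by (rule M'.cochain_ext_complex[OF N])

abbreviation "pullback i f \<equiv> (\<lambda>v \<in> carrier (M.F i). f (res_map R h v))"

lemma pullback_hom: "pullback i \<in> mod_hom R (ext_complex R M' N i) (ext_complex R M N i)"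
  unfolding ext_complex_def
proof (rule mod_homI)
  interpret F: Module.module R "M.F i" by (rule M.module_F)
  fix f :: "(('a, 'k) cell \<Rightarrow> 'a) \<Rightarrow> 'n"
  assume "f \<in> carrier (hom_module R (M'.F i) N)"
  then have f: "f \<in> mod_hom R (M'.F i) N" by simp
  then show "pullback i f \<in> carrier (hom_module R (M.F i) N)"
    using restrict_mod_hom[OF M.module_F mod_hom_comp[OF res_map_hom f]] by simp
qed (auto simp: mod_hom_closed[OF res_map_hom] intro!: restrict_ext)

lemma pullback_comm:
  "ext_diff R M i (pullback i f) = pullback (Suc i) (ext_diff R M' i f)"
  using mod_hom_closed[OF M.diff_hom] mod_hom_closed[OF res_map_hom]
  by (auto simp: ext_diff_def bdry_res_map intro!: restrict_ext)

lemma Ext_map_hom: "Ext_map R i M N h \<in> mod_hom R (Ext R i M' N) (Ext R i M N)"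
  unfolding Ext_map_def Ext_def
  by (rule C'.cohomology_map(1)[OF C.cochain_complex_axioms, of pullback])
    (simp_all add: pullback_hom pullback_comm)

lemma Ext_map_coset:
  assumes "f \<in> cocycles (ext_complex R M' N) (ext_diff R M') i"
  shows "Ext_map R i M N h (coboundaries (ext_complex R M' N) (ext_diff R M') i +>\<^bsub>ext_complex R M' N i\<^esub> f)
    = coboundaries (ext_complex R M N) (ext_diff R M) i +>\<^bsub>ext_complex R M N i\<^esub> pullback i f"
  unfolding Ext_map_def
  by (rule C'.cohomology_map(2)[OF C.cochain_complex_axioms, of pullback])
    (simp_all add: pullback_hom pullback_comm assms)

end

end

text \<open>No homotopy is involved: \<open>res_map R h\<close> fixes every vector of
  \<open>F i\<close>, so composing with it returns the same extensional cochain and hence the same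
  class.\<close>

lemma (in free_resolution) Ext_map_id:
  assumes N: "Module.module R N" and h: "\<And>x. x \<in> carrier M \<Longrightarrow> h x = x"
    and X: "X \<in> carrier (Ext R i M N)"
  shows "Ext_map R i M N h X = X"
proof -
  interpret h: resolution_map R M M h
    by unfold_locales (auto simp: mod_hom_def h)
  let ?C = "ext_complex R M N" and ?d = "ext_diff R M"
  obtain f where f: "f \<in> cocycles ?C ?d i" "X = coboundaries ?C ?d i +>\<^bsub>?C i\<^esub> f"
    using X by (auto simp: Ext_def cohomology_def a_r_coset_carrier_update)
  have "(\<lambda>v \<in> carrier (F i). f (res_map R h v)) = f"
    using f(1) res_map_id[of h, OF h]
    by (intro extensionalityI[of _ "carrier (F i)"]) (auto simp: cocycles_def ext_complex_def)
  then show ?thesis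
    using h.Ext_map_coset[OF N f(1)] f(2) by simp
qed

section \<open>Direct limits\<close>

locale direct_system =
  fixes R :: "('a, 'r) ring_scheme" and E :: "nat \<Rightarrow> ('a, 'e, 'x) module_scheme"
    and t :: "nat \<Rightarrow> 'e \<Rightarrow> 'e"
  assumes module_E: "\<And>n. Module.module R (E n)"
    and hom_t: "\<And>n. t n \<in> mod_hom R (E n) (E (Suc n))"
begin

text \<open>Indexed by source and target stage instead of the number of steps, so that the
  composition law \<open>tr_tr\<close> needs no arithmetic on indices.\<close>

definition tr :: "nat \<Rightarrow> nat \<Rightarrow> 'e \<Rightarrow> 'e" where "tr m n = dl_trans t m (n - m)"

lemma dl_trans_hom: "dl_trans t m k \<in> mod_hom R (E m) (E (m + k))"
proof (induction k)
  case 0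
  show ?case by (auto simp: mod_hom_def)
next
  case (Suc k)
  show ?case using mod_hom_comp[OF Suc hom_t] by (simp add: comp_def)
qed

lemma dl_trans_add: "dl_trans t m (k + l) x = dl_trans t (m + k) l (dl_trans t m k x)"
  by (induction l) (simp_all add: add.assoc)

lemma tr_hom: "m \<le> n \<Longrightarrow> tr m n \<in> mod_hom R (E m) (E n)"
  using dl_trans_hom[of m "n - m"] by (simp add: tr_def)

lemma tr_tr: "l \<le> m \<Longrightarrow> m \<le> n \<Longrightarrow> tr m n (tr l m x) = tr l n x"
  using dl_trans_add[of l "m - l" "n - m" x] by (simp add: tr_def)

lemma tr_self [simp]: "tr m m x = x"
  by (simp add: tr_def)

definition cls :: "nat \<Rightarrow> 'e \<Rightarrow> (nat \<times> 'e) set" where "cls n x = dl_rel E t `` {(n, x)}"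

lemma dl_rel_iff:
  "((m, x), (n, y)) \<in> dl_rel E t \<longleftrightarrow> x \<in> carrier (E m) \<and> y \<in> carrier (E n) \<and>
    (\<exists>k. m \<le> k \<and> n \<le> k \<and> tr m k x = tr n k y)"
  by (simp add: dl_rel_def tr_def)

lemma equiv_dl_rel: "equiv (SIGMA n:UNIV. carrier (E n)) (dl_rel E t)"
proof (rule equivI)
  show "dl_rel E t \<subseteq> (SIGMA n:UNIV. carrier (E n)) \<times> (SIGMA n:UNIV. carrier (E n))"
    by (auto simp: dl_rel_def)
  show "refl_on (SIGMA n:UNIV. carrier (E n)) (dl_rel E t)"
    by (auto simp: refl_on_def dl_rel_iff)
  show "sym (dl_rel E t)"
    by (rule symI) (auto simp: dl_rel_iff, metis)
  show "trans (dl_rel E t)"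
  proof (rule transI, clarify)
    fix l x m y n z
    assume 1: "((l, x), (m, y)) \<in> dl_rel E t" and 2: "((m, y), (n, z)) \<in> dl_rel E t"
    obtain j k where j: "l \<le> j" "m \<le> j" "tr l j x = tr m j y" and k: "m \<le> k" "n \<le> k" "tr m k y = tr n k z"
      using 1 2 by (auto simp: dl_rel_iff)
    \<comment> \<open>\<open>x\<close> meets \<open>y\<close> at stage \<open>j\<close> and
      \<open>y\<close> meets \<open>z\<close> at stage \<open>k\<close>; beyond both, all three
      agree.\<close>
    define i where "i = max j k"
    have i: "j \<le> i" "k \<le> i" by (auto simp: i_def)
    have "tr l i x = tr n i z"
      using tr_tr[OF j(1) i(1), of x] tr_tr[OF j(2) i(1), of y] tr_tr[OF k(1) i(2), of y]
        tr_tr[OF k(2) i(2), of z] j(3) k(3) by simp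
    then show "((l, x), (n, z)) \<in> dl_rel E t"
      using 1 2 j k i by (auto simp: dl_rel_iff intro!: exI[of _ i])
  qed
qed

lemma cls_eqI:
  assumes "x \<in> carrier (E m)" "y \<in> carrier (E n)" "m \<le> k" "n \<le> k" "tr m k x = tr n k y"
  shows "cls m x = cls n y"
  unfolding cls_def using assms
  by (intro equiv_class_eq[OF equiv_dl_rel]) (auto simp: dl_rel_iff)

lemma cls_tr: "x \<in> carrier (E m) \<Longrightarrow> m \<le> n \<Longrightarrow> cls n (tr m n x) = cls m x"
  by (rule cls_eqI[of _ _ _ _ n]) (auto intro: mod_hom_closed[OF tr_hom])

lemma cls_self: "x \<in> carrier (E m) \<Longrightarrow> (m, x) \<in> cls m x"
  by (auto simp: cls_def dl_rel_iff)

lemma in_cls_iff: "(n, y) \<in> cls m x \<longleftrightarrow> x \<in> carrier (E m) \<and> y \<in> carrier (E n) \<and>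
    (\<exists>k. m \<le> k \<and> n \<le> k \<and> tr m k x = tr n k y)"
  by (simp add: cls_def dl_rel_iff)

lemma carrier_direct_limit: "X \<in> carrier (direct_limit E t) \<longleftrightarrow> (\<exists>n. \<exists>x \<in> carrier (E n). X = cls n x)"
  by (auto simp: direct_limit_def quotient_def cls_def)

text \<open>The sum in the limit is a union over all pairs of representatives, which may live at
  different stages. All members of the union are the same class, so the sum can be formed at any
  common stage.\<close>

lemma cls_add:
  assumes x: "x \<in> carrier (E n)" and y: "y \<in> carrier (E n)"
  shows "cls n x \<oplus>\<^bsub>direct_limit E t\<^esub> cls n y = cls n (x \<oplus>\<^bsub>E n\<^esub> y)"
proof -
  have *: "cls (max m m') (dl_trans t m (max m m' - m) x' \<oplus>\<^bsub>E (max m m')\<^esub> dl_trans t m' (max m m' - m') y')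
      = cls n (x \<oplus>\<^bsub>E n\<^esub> y)" if x': "(m, x') \<in> cls n x" and y': "(m', y') \<in> cls n y" for m x' m' y'
  proof -
    obtain j k where j: "n \<le> j" "m \<le> j" "tr n j x = tr m j x'" "x' \<in> carrier (E m)"
      and k: "n \<le> k" "m' \<le> k" "tr n k y = tr m' k y'" "y' \<in> carrier (E m')"
      using x' y' by (auto simp: in_cls_iff)
    \<comment> \<open>The sum of representatives is formed at stage \<open>p\<close>; only at the
      later stage \<open>i\<close> are both known to agree with \<open>x\<close> and
      \<open>y\<close>.\<close>
    define p where "p = max m m'"
    define i where "i = max j k"
    have i: "j \<le> i" "k \<le> i" "n \<le> i" "p \<le> i" "m \<le> p" "m' \<le> p"
      using j k by (auto simp: i_def p_def)
    have jj: "tr n i x = tr m i x'"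
      using tr_tr[OF j(1) i(1), of x] tr_tr[OF j(2) i(1), of x'] j(3) by simp
    have kk: "tr n i y = tr m' i y'"
      using tr_tr[OF k(1) i(2), of y] tr_tr[OF k(2) i(2), of y'] k(3) by simp
    interpret Ep: Module.module R "E p" by (rule module_E)
    interpret En: Module.module R "E n" by (rule module_E)
    have c: "tr m p x' \<in> carrier (E p)" "tr m' p y' \<in> carrier (E p)"
      using mod_hom_closed[OF tr_hom[OF i(5)] j(4)] mod_hom_closed[OF tr_hom[OF i(6)] k(4)] by auto
    have "tr p i (tr m p x' \<oplus>\<^bsub>E p\<^esub> tr m' p y') = tr m i x' \<oplus>\<^bsub>E i\<^esub> tr m' i y'"
      using mod_hom_add[OF tr_hom[OF i(4)] c] tr_tr[OF i(5,4)] tr_tr[OF i(6,4)] by simp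
    also have "\<dots> = tr n i (x \<oplus>\<^bsub>E n\<^esub> y)"
      using mod_hom_add[OF tr_hom[OF i(3)] x y] jj kk by simp
    finally have "cls p (tr m p x' \<oplus>\<^bsub>E p\<^esub> tr m' p y') = cls n (x \<oplus>\<^bsub>E n\<^esub> y)"
      using c x y i by (intro cls_eqI[of _ _ _ _ i]) auto
    then show ?thesis by (simp add: p_def tr_def)
  qed
  have "cls n x \<oplus>\<^bsub>direct_limit E t\<^esub> cls n y = (\<Union>(m, x') \<in> cls n x. \<Union>(m', y') \<in> cls n y.
      cls (max m m') (dl_trans t m (max m m' - m) x' \<oplus>\<^bsub>E (max m m')\<^esub> dl_trans t m' (max m m' - m') y'))"
    by (simp add: direct_limit_def cls_def)
  also have "\<dots> = (\<Union>p \<in> cls n x. \<Union>q \<in> cls n y. cls n (x \<oplus>\<^bsub>E n\<^esub> y))"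
    using * by (intro SUP_cong refl) (auto simp: split_beta)
  also have "\<dots> = cls n (x \<oplus>\<^bsub>E n\<^esub> y)"
    using cls_self[OF x] cls_self[OF y] by auto
  finally show ?thesis .
qed

lemma cls_smult:
  assumes r: "r \<in> carrier R" and x: "x \<in> carrier (E n)"
  shows "r \<odot>\<^bsub>direct_limit E t\<^esub> cls n x = cls n (r \<odot>\<^bsub>E n\<^esub> x)"
proof -
  have *: "cls m (r \<odot>\<^bsub>E m\<^esub> y) = cls n (r \<odot>\<^bsub>E n\<^esub> x)" if my: "(m, y) \<in> cls n x" for m y
  proof -
    obtain k where k: "n \<le> k" "m \<le> k" "tr n k x = tr m k y" "y \<in> carrier (E m)"
      using my by (auto simp: in_cls_iff)
    interpret Em: Module.module R "E m" by (rule module_E)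
    interpret En: Module.module R "E n" by (rule module_E)
    show ?thesis
      using k r x mod_hom_smult[OF tr_hom[OF k(2)] r k(4)] mod_hom_smult[OF tr_hom[OF k(1)] r x]
      by (intro cls_eqI[of _ _ _ _ k]) auto
  qed
  have "r \<odot>\<^bsub>direct_limit E t\<^esub> cls n x = (\<Union>(m, y) \<in> cls n x. cls m (r \<odot>\<^bsub>E m\<^esub> y))"
    by (simp add: direct_limit_def cls_def)
  also have "\<dots> = (\<Union>p \<in> cls n x. cls n (r \<odot>\<^bsub>E n\<^esub> x))"
    using * by (intro SUP_cong refl) (auto simp: split_beta)
  also have "\<dots> = cls n (r \<odot>\<^bsub>E n\<^esub> x)"
    using cls_self[OF x] by auto
  finally show ?thesis .
qed

lemma cls_hom: "cls n \<in> mod_hom R (E n) (direct_limit E t)"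
  by (rule mod_homI) (auto simp: cls_add cls_smult carrier_direct_limit)

lemma cls_zero: "cls n \<zero>\<^bsub>E n\<^esub> = \<zero>\<^bsub>direct_limit E t\<^esub>"
proof -
  interpret E0: Module.module R "E 0" by (rule module_E)
  have "cls n \<zero>\<^bsub>E n\<^esub> = cls n (tr 0 n \<zero>\<^bsub>E 0\<^esub>)"
    using mod_hom_zero[OF module_E module_E tr_hom[of 0 n]] by simp
  also have "\<dots> = cls 0 \<zero>\<^bsub>E 0\<^esub>" by (rule cls_tr) auto
  finally show ?thesis by (simp add: cls_def direct_limit_def)
qed

text \<open>Every class can be pulled back to stage \<open>n\<close>, so \<open>cls n\<close> is
  onto. Through \<open>fg_surj_image\<close> this map also provides the module structure of the
  limit.\<close>

lemma fg_direct_limit: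
  assumes fg: "fg_module R (E n)"
    and surj: "\<And>m. n \<le> m \<Longrightarrow> t m ` carrier (E m) = carrier (E (Suc m))"
  shows "fg_module R (direct_limit E t)"
proof (rule fg_surj_image[OF fg cls_hom _ cls_zero])
  have tr_surj: "tr n m ` carrier (E n) = carrier (E m)" if "n \<le> m" for m
    using that
  proof (induction rule: dec_induct)
    case base
    show ?case by simp
  next
    case (step m)
    have "tr n (Suc m) x = t m (tr n m x)" for x
      using step by (simp add: tr_def Suc_diff_le)
    then have "tr n (Suc m) ` carrier (E n) = t m ` tr n m ` carrier (E n)"
      by (simp add: image_image)
    then show ?case using step surj by simp
  qed
  show "cls n ` carrier (E n) = carrier (direct_limit E t)"
  proof (intro equalityI subsetI)
    fix X assume "X \<in> carrier (direct_limit E t)"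
    then obtain m x where x: "x \<in> carrier (E m)" "X = cls m x" by (auto simp: carrier_direct_limit)
    define p where "p = max m n"
    have p: "m \<le> p" "n \<le> p" by (auto simp: p_def)
    have "tr m p x \<in> tr n p ` carrier (E n)"
      using mod_hom_closed[OF tr_hom[OF p(1)] x(1)] tr_surj[OF p(2)] by simp
    then obtain y where y: "y \<in> carrier (E n)" "tr m p x = tr n p y" by auto
    have "X = cls n y"
      unfolding x(2) by (rule cls_eqI[OF x(1) y(1) p y(2)])
    then show "X \<in> cls n ` carrier (E n)" using y(1) by blast
  qed (auto simp: carrier_direct_limit)
qed

end

section \<open>Generalized local cohomology\<close>

lemma (in cring) ideal_power_ideal:
  assumes "ideal I R"
  shows "ideal (ideal_power R I n) R"
proof -
  interpret J: comm_monoid "ideals_set R" by (rule ideals_set_is_comm_monoid)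
  have "I [^]\<^bsub>ideals_set R\<^esub> n \<in> carrier (ideals_set R)"
    using assms by (intro J.nat_pow_closed) (simp add: ideals_set_def)
  then show ?thesis by (simp add: ideal_power_def ideals_set_def)
qed

lemma (in cring) ideal_power_Suc_subset:
  assumes "ideal I R"
  shows "ideal_power R I (Suc n) \<subseteq> ideal_power R I n"
proof -
  interpret J: comm_monoid "ideals_set R" by (rule ideals_set_is_comm_monoid)
  have "ideal_power R I (Suc n) = ideal_power R I n \<cdot> I"
    by (simp add: ideal_power_def ideals_set_def)
  then show ?thesis
    using ideal_prod_inter[OF ideal_power_ideal[OF assms] assms] by auto
qed

lemma (in cring) ideal_power_antimono:
  assumes "ideal I R" "m \<le> n"
  shows "ideal_power R I n \<subseteq> ideal_power R I m"
  using lift_Suc_antimono_le[of "ideal_power R I", OF ideal_power_Suc_subset[OF assms(1)] assms(2)] .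

context Module.module
begin

lemma submodule_ideal_smult:
  assumes "ideal I R"
  shows "submodule (ideal_smult R I M) R M"
  unfolding ideal_smult_def using ideal.Icarr[OF assms] by (intro submodule_gen) auto

lemma ideal_smult_mono:
  "I \<subseteq> J \<Longrightarrow> ideal_smult R I M \<subseteq> ideal_smult R J M"
  unfolding ideal_smult_def by (intro gen_submodule_mono) blast

lemma submodule_zero: "submodule {\<zero>\<^bsub>M\<^esub>} R M"
  by (rule submoduleI') auto

text \<open>The largest exponent among finitely many generators works for all of \<open>M\<close>,
  because the elements killed by an ideal form a submodule.\<close>

lemma fg_torsion_annihilated:
  assumes I: "ideal I R" and fg: "fg_module R M" and tors: "carrier M = torsion R I M"
  shows "\<exists>n. \<forall>r \<in> ideal_power R I n. \<forall>x \<in> carrier M. r \<odot>\<^bsub>M\<^esub> x = \<zero>\<^bsub>M\<^esub>"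
proof -
  obtain S where S: "finite S" "S \<subseteq> carrier M" "gen_submodule R M S = carrier M"
    using fg by (auto simp: fg_module_def)
  have "\<forall>x \<in> S. \<exists>n. \<forall>r \<in> ideal_power R I n. r \<odot>\<^bsub>M\<^esub> x = \<zero>\<^bsub>M\<^esub>"
  proof
    fix x assume "x \<in> S"
    then have "x \<in> torsion R I M" using S(2) unfolding tors[symmetric] by blast
    then show "\<exists>n. \<forall>r \<in> ideal_power R I n. r \<odot>\<^bsub>M\<^esub> x = \<zero>\<^bsub>M\<^esub>"
      by (simp add: torsion_def)
  qed
  from bchoice[OF this]
  obtain n where n: "\<forall>x \<in> S. \<forall>r \<in> ideal_power R I (n x). r \<odot>\<^bsub>M\<^esub> x = \<zero>\<^bsub>M\<^esub>" ..
  \<comment> \<open>The extra 0 keeps the maximum defined when \<open>S\<close> is empty.\<close>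
  define m where "m = Max (insert 0 (n ` S))"
  have le: "n x \<le> m" if "x \<in> S" for x
    using that S(1) by (auto simp: m_def)
  let ?J = "ideal_power R I m"
  have J: "r \<in> carrier R" if "r \<in> ?J" for r
    using ideal.Icarr[OF ideal_power_ideal[OF I]] that .
  let ?A = "{x \<in> carrier M. \<forall>r \<in> ?J. r \<odot>\<^bsub>M\<^esub> x = \<zero>\<^bsub>M\<^esub>}"
  have "submodule ?A R M"
  proof (rule submoduleI')
    fix a x assume a: "a \<in> carrier R" and x: "x \<in> ?A"
    have "r \<odot>\<^bsub>M\<^esub> (a \<odot>\<^bsub>M\<^esub> x) = \<zero>\<^bsub>M\<^esub>" if r: "r \<in> ?J" for r
    proof -
      have "r \<odot>\<^bsub>M\<^esub> (a \<odot>\<^bsub>M\<^esub> x) = a \<odot>\<^bsub>M\<^esub> (r \<odot>\<^bsub>M\<^esub> x)"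
        using a x J[OF r] by (simp add: smult_assoc1[symmetric] m_comm)
      then show ?thesis using x r a by simp
    qed
    then show "a \<odot>\<^bsub>M\<^esub> x \<in> ?A" using a x by simp
  qed (auto simp: smult_r_distr J)
  moreover have "S \<subseteq> ?A"
    using S(2) n ideal_power_antimono[OF I le] by blast
  ultimately have "carrier M \<subseteq> ?A"
    using gen_submodule_least[of ?A R M S] S(3) by simp
  then show ?thesis by blast
qed

lemma ideal_smult_annihilated:
  assumes "\<And>r x. r \<in> I \<Longrightarrow> x \<in> carrier M \<Longrightarrow> r \<odot>\<^bsub>M\<^esub> x = \<zero>\<^bsub>M\<^esub>"
  shows "ideal_smult R I M = {\<zero>\<^bsub>M\<^esub>}"
proof
  show "ideal_smult R I M \<subseteq> {\<zero>\<^bsub>M\<^esub>}"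
    unfolding ideal_smult_def using assms by (intro gen_submodule_least submodule_zero) auto
  show "{\<zero>\<^bsub>M\<^esub>} \<subseteq> ideal_smult R I M"
    unfolding ideal_smult_def using assms by (auto simp: gen_submodule_def submodule_zero_closed)
qed

lemma module_power_quotient:
  assumes "ideal I R"
  shows "Module.module R (power_quotient R I M n)"
  unfolding power_quotient_def
  by (rule quotient_module_module[OF submodule_ideal_smult[OF ideal_power_ideal[OF assms]]])

lemma power_quotient_proj_hom:
  assumes I: "ideal I R"
  shows "power_quotient_proj R I M n \<in> mod_hom R (power_quotient R I M (Suc n)) (power_quotient R I M n)"
proof -
  note sub = submodule_ideal_smult[OF ideal_power_ideal[OF I]]
  have "(\<lambda>x. x) \<in> mod_hom R M M" by (auto simp: mod_hom_def)
  then have "(\<lambda>X. \<Union>x \<in> X. ideal_smult R (ideal_power R I n) M +>\<^bsub>M\<^esub> x)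
      \<in> mod_hom R (power_quotient R I M (Suc n)) (power_quotient R I M n)"
    unfolding power_quotient_def
    using ideal_smult_mono[OF ideal_power_Suc_subset[OF I, of n]]
    by (intro quotient_map_hom[OF sub module_axioms sub]) auto
  then show ?thesis by (simp add: power_quotient_proj_def[abs_def])
qed

end

text \<open>Once \<open>I\<^sup>n\<close> kills \<open>M\<close>, all later quotients are literally
  the quotient of \<open>M\<close> by its zero submodule. The later \<open>Ext\<close> modules are
  therefore equal as records, and the transition maps fix each of their elements.\<close>

lemma fg_gen_local_cohomology:
  assumes cring: "cring R" and noeth: "noetherian_ring R" and I: "ideal I R"
    and M: "fg_module R M" and N: "fg_module R N" and tors: "carrier M = torsion R I M"
  shows "fg_module R (gen_local_cohomology R I i M N)"
proof -
  have Mm: "Module.module R M" and Nm: "Module.module R N" using M N by (simp_all add: fg_module_def)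
  interpret M: Module.module R M by (rule Mm)
  let ?Q = "power_quotient R I M" and ?p = "power_quotient_proj R I M"
  let ?E = "\<lambda>n. Ext R i (?Q n) N" and ?t = "\<lambda>n. Ext_map R i (?Q (Suc n)) N (?p n)"
  have res: "free_resolution R (?Q n)" for n
    by (rule free_resolution.intro[OF M.module_power_quotient[OF I]])
  have map: "resolution_map R (?Q (Suc n)) (?Q n) (?p n)" for n
    by (intro resolution_map.intro resolution_map_axioms.intro res M.power_quotient_proj_hom[OF I])
  have sys: "direct_system R ?E ?t"
    by (intro direct_system.intro free_resolution.Ext_module[OF res Nm] resolution_map.Ext_map_hom[OF map Nm])
  obtain n where n: "\<forall>r \<in> ideal_power R I n. \<forall>x \<in> carrier M. r \<odot>\<^bsub>M\<^esub> x = \<zero>\<^bsub>M\<^esub>"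
    using M.fg_torsion_annihilated[OF I M tors] by blast
  have smult0: "ideal_smult R (ideal_power R I m) M = {\<zero>\<^bsub>M\<^esub>}" if "n \<le> m" for m
    using n M.R.ideal_power_antimono[OF I that] by (intro M.ideal_smult_annihilated) blast
  have Q: "?Q m = quotient_module M {\<zero>\<^bsub>M\<^esub>}" if "n \<le> m" for m
    by (simp add: power_quotient_def smult0[OF that])
  \<comment> \<open>The stable term is not \<open>M\<close> itself but its module of cosets of zero,
    which is finitely generated as an image of \<open>M\<close>.\<close>
  have Q_fg: "fg_module R (?Q n)"
    unfolding Q[OF le_refl]
    by (rule fg_surj_image[OF M M.coset_hom[OF M.submodule_zero]])
      (auto simp: M.coset_zero[OF M.submodule_zero])
  have p: "?p m X = X" if m: "n \<le> m" and X: "X \<in> carrier (?Q m)" for m X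
  proof -
    obtain x where x: "x \<in> carrier M" "X = {\<zero>\<^bsub>M\<^esub>} +>\<^bsub>M\<^esub> x" using X Q[OF m] by auto
    have "(\<Union>y \<in> {\<zero>\<^bsub>M\<^esub>} +>\<^bsub>M\<^esub> x. {\<zero>\<^bsub>M\<^esub>} +>\<^bsub>M\<^esub> y) = {\<zero>\<^bsub>M\<^esub>} +>\<^bsub>M\<^esub> x"
      by (rule M.quotient_map_coset[OF M.submodule_zero Mm M.submodule_zero _ _ x(1), of "\<lambda>y. y"])
        (auto simp: mod_hom_def)
    then show ?thesis by (simp add: power_quotient_proj_def smult0[OF m] x(2))
  qed
  have t: "?t m X = X" if m: "n \<le> m" and X: "X \<in> carrier (?E m)" for m X
  proof -
    \<comment> \<open>This equality makes \<open>?p m\<close> a map from a module to itself, as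
      \<open>Ext_map_id\<close> demands.\<close>
    have "?Q (Suc m) = ?Q m" using Q[of m] Q[of "Suc m"] m by simp
    then show ?thesis
      using free_resolution.Ext_map_id[OF res[of m] Nm p[OF m] X] by simp
  qed
  show ?thesis
    unfolding gen_local_cohomology_def
  proof (rule direct_system.fg_direct_limit[OF sys])
    show "fg_module R (?E n)"
      by (rule free_resolution.Ext_fg[OF res noeth Q_fg N])
    fix m assume m: "n \<le> m"
    have "?E (Suc m) = ?E m" using Q[of m] Q[of "Suc m"] m by simp
    then show "?t m ` carrier (?E m) = carrier (?E (Suc m))"
      using t[OF m] by simp
  qed
qed

theorem proposition3p6:
  fixes R :: "('a, 'r) ring_scheme"
    and \<aa> :: "'a set"
    and M :: "('a, 'm, 'x) module_scheme"
    and N :: "('a, 'n, 'y) module_scheme"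
  assumes "cring R" and "noetherian_ring R"
    and "ideal \<aa> R"
    and "fg_module R M" and "fg_module R N"
    and "carrier M = torsion R \<aa> M"
    and "cd R \<aa> N = 1"
  shows "\<forall>i. fg_module R (gen_local_cohomology R \<aa> i M N)"
  using assms by (blast intro: fg_gen_local_cohomology)

end
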